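(* There exist constants $\alpha>1$ and $0<\beta<1$ such that the following holds. Let $H$ be a pseudoexpander with a sufficiently large number $n=|V(H)|$ of vertices, let $d\le \log n/10^5$, and let $Z$ be a uniform read-$d$-times non-deterministic branching program computing $\phi_H$. Then $|Z|\ge \alpha^{n^{\beta}}$.
   Context: Logarithms are base 2. A set of literals never contains both a variable and its negation; $Vars(S)$ is the set of variables occurring in $S$; $S$ represents the assignment setting positively occurring variables to true and negatively occurring ones to false. A rooted tree is extended if none of its leaves has a sibling. A graph $H$ is a binary tree based graph if it is the edge-disjoint union of extended rooted trees $T_1,\dots,T_m$ with roots $t_1,\dots,t_m$ (the roots of $H$, forming ${\bf Roots}(H)$) such that every vertex of ${\bf Leaves}(H)$ (the set of all leaves of the $T_i$) is a leaf of exactly two of the trees, and any two of the trees have at most one common vertex, which is then a leaf of both. Write $n=|V(H)|$, $m=|{\bf Roots}(H)|$. $T_i,T_j$ are adjacent if they share a leaf, denoted $\ell_{i,j}$; $P_{i,j}$ is the unique path between $t_i$ and $t_j$ in $T_i\cup T_j$. A pseudoedge is a pair $\{t_i,t_j\}$ with $T_i,T_j$ adjacent; a pseudomatching is a set of pairwise disjoint pseudoedges; it is between disjoint $U,V\subseteq{\bf Roots}(H)$ if each of its pseudoedges has one end in $U$ and one in $V$. $H$ is a pseudoexpander if (1) each $T_i$ has height (largest number of vertices on a root-leaf path) at most $(\log m)/4.9+3$, and (2) for any two disjoint $U,V\subseteq {\bf Roots}(H)$ with $|U|,|V|\ge m^{0.999}$ there is a pseudomatching between $U$ and $V$ of size at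 least $m^{0.999}/3$. The CNF $\phi_H$ has variable set $V(H)$ and, for each pseudoedge $\{t_i,t_j\}$, a clause $C_{i,j}$ whose literals are the positive literals of the vertices of $P_{i,j}$. A non-deterministic branching program (NBP) $Z$ is a directed acyclic multigraph with one source and one sink, some of whose edges are labelled with literals; $Vars(Z)$ is the set of variables labelling its edges. A source-sink path $P$ is computational if no variable occurs on it both positively and negatively; $A(P)$ is the set of literals labelling $P$. $Z$ computes the function on $Vars(Z)$ whose satisfying assignments are exactly the total assignments $S$ such that $A(P)\subseteq S$ for some computational path $P$. $|Z|$ is the number of vertices. $Z$ is a read-$d$-times NBP if each variable labels at most $d$ edges of each source-sink path, and it is uniform if each variable labels exactly $d$ edges of each source-sink path. *)

theory Defs
  imports Main "HOL.Transcendental"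
begin

definition upath :: "'v set set \<Rightarrow> 'v list \<Rightarrow> 'v \<Rightarrow> 'v \<Rightarrow> bool" where
  "upath E p u v \<longleftrightarrow> p \<noteq> [] \<and> hd p = u \<and> last p = v \<and> distinct p \<and>
     (\<forall>k. k + 1 < length p \<longrightarrow> {p ! k, p ! (k + 1)} \<in> E)"

definition is_tree :: "'v set \<Rightarrow> 'v set set \<Rightarrow> bool" where
  "is_tree V E \<longleftrightarrow> finite V \<and> V \<noteq> {} \<and>
     E \<subseteq> {{u, w} | u w. u \<in> V \<and> w \<in> V \<and> u \<noteq> w} \<and>
     (\<forall>u\<in>V. \<forall>w\<in>V. \<exists>p. upath E p u w) \<and>
     card E + 1 = card V"

definition rooted_tree :: "'v set \<Rightarrow> 'v set set \<Rightarrow> 'v \<Rightarrow> bool" where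
  "rooted_tree V E r \<longleftrightarrow> is_tree V E \<and> r \<in> V"

definition children :: "'v set set \<Rightarrow> 'v \<Rightarrow> 'v \<Rightarrow> 'v set" where
  "children E r p = {u. {p, u} \<in> E \<and> (\<exists>q. upath E q u r \<and> p \<in> set q)}"

definition tree_leaves :: "'v set \<Rightarrow> 'v set set \<Rightarrow> 'v \<Rightarrow> 'v set" where
  "tree_leaves V E r = {v \<in> V. children E r v = {}}"

definition extended_tree :: "'v set \<Rightarrow> 'v set set \<Rightarrow> 'v \<Rightarrow> bool" where
  "extended_tree V E r \<longleftrightarrow> rooted_tree V E r \<and>
     (\<forall>l \<in> tree_leaves V E r. \<forall>p. l \<in> children E r p \<longrightarrow> children E r p = {l})"

definition HV :: "nat \<Rightarrow> (nat \<Rightarrow> nat set) \<Rightarrow> nat set" where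
  "HV m TV = (\<Union>i<m. TV i)"

definition HLeaves :: "nat \<Rightarrow> (nat \<Rightarrow> nat set) \<Rightarrow> (nat \<Rightarrow> nat set set) \<Rightarrow> (nat \<Rightarrow> nat) \<Rightarrow> nat set" where
  "HLeaves m TV TE r = (\<Union>i<m. tree_leaves (TV i) (TE i) (r i))"

definition btb_graph :: "nat \<Rightarrow> (nat \<Rightarrow> nat set) \<Rightarrow> (nat \<Rightarrow> nat set set) \<Rightarrow> (nat \<Rightarrow> nat) \<Rightarrow> bool" where
  "btb_graph m TV TE r \<longleftrightarrow>
     (\<forall>i<m. extended_tree (TV i) (TE i) (r i)) \<and>
     inj_on r {..<m} \<and>
     (\<forall>i<m. \<forall>j<m. i \<noteq> j \<longrightarrow> TE i \<inter> TE j = {}) \<and>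
     (\<forall>l \<in> HLeaves m TV TE r. card {i. i < m \<and> l \<in> tree_leaves (TV i) (TE i) (r i)} = 2) \<and>
     (\<forall>i<m. \<forall>j<m. i \<noteq> j \<longrightarrow> card (TV i \<inter> TV j) \<le> 1 \<and>
        (\<forall>v \<in> TV i \<inter> TV j. v \<in> tree_leaves (TV i) (TE i) (r i) \<and> v \<in> tree_leaves (TV j) (TE j) (r j)))"

definition adjacent_trees :: "nat \<Rightarrow> (nat \<Rightarrow> nat set) \<Rightarrow> (nat \<Rightarrow> nat set set) \<Rightarrow> (nat \<Rightarrow> nat) \<Rightarrow> nat \<Rightarrow> nat \<Rightarrow> bool" where
  "adjacent_trees m TV TE r i j \<longleftrightarrow> i < m \<and> j < m \<and> i \<noteq> j \<and>
     (\<exists>l. l \<in> tree_leaves (TV i) (TE i) (r i) \<and> l \<in> tree_leaves (TV j) (TE j) (r j))"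

text \<open>Vertex set of P_{i,j}, the unique path between t_i and t_j in T_i \<union> T_j.\<close>
definition Ppath_vertices :: "(nat \<Rightarrow> nat set set) \<Rightarrow> (nat \<Rightarrow> nat) \<Rightarrow> nat \<Rightarrow> nat \<Rightarrow> nat set" where
  "Ppath_vertices TE r i j = {w. \<exists>p. upath (TE i \<union> TE j) p (r i) (r j) \<and> w \<in> set p}"

text \<open>Pseudoedges as unordered pairs of tree indices (equivalently of roots, since r is injective).\<close>
definition pseudomatching_between ::
  "nat \<Rightarrow> (nat \<Rightarrow> nat set) \<Rightarrow> (nat \<Rightarrow> nat set set) \<Rightarrow> (nat \<Rightarrow> nat) \<Rightarrow> nat set set \<Rightarrow> nat set \<Rightarrow> nat set \<Rightarrow> bool" where
  "pseudomatching_between m TV TE r M U W \<longleftrightarrow>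
     (\<forall>e\<in>M. \<exists>i j. e = {i, j} \<and> adjacent_trees m TV TE r i j \<and> i \<in> U \<and> j \<in> W) \<and>
     (\<forall>e\<in>M. \<forall>e'\<in>M. e \<noteq> e' \<longrightarrow> e \<inter> e' = {})"

definition tree_height_ok :: "nat \<Rightarrow> (nat \<Rightarrow> nat set) \<Rightarrow> (nat \<Rightarrow> nat set set) \<Rightarrow> (nat \<Rightarrow> nat) \<Rightarrow> bool" where
  "tree_height_ok m TV TE r \<longleftrightarrow>
     (\<forall>i<m. \<forall>l \<in> tree_leaves (TV i) (TE i) (r i). \<forall>p. upath (TE i) p (r i) l \<longrightarrow>
        real (length p) \<le> log 2 (real m) / 4.9 + 3)"

definition pseudoexpander :: "nat \<Rightarrow> (nat \<Rightarrow> nat set) \<Rightarrow> (nat \<Rightarrow> nat set set) \<Rightarrow> (nat \<Rightarrow> nat) \<Rightarrow> bool" where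
  "pseudoexpander m TV TE r \<longleftrightarrow> btb_graph m TV TE r \<and> tree_height_ok m TV TE r \<and>
     (\<forall>U W. U \<subseteq> {..<m} \<longrightarrow> W \<subseteq> {..<m} \<longrightarrow> U \<inter> W = {} \<longrightarrow>
        real (card U) \<ge> real m powr 0.999 \<longrightarrow> real (card W) \<ge> real m powr 0.999 \<longrightarrow>
        (\<exists>M. pseudomatching_between m TV TE r M U W \<and> real (card M) \<ge> real m powr 0.999 / 3))"

text \<open>The CNF phi_H, as the Boolean function it defines on assignments \<sigma>.\<close>
definition phi_H :: "nat \<Rightarrow> (nat \<Rightarrow> nat set) \<Rightarrow> (nat \<Rightarrow> nat set set) \<Rightarrow> (nat \<Rightarrow> nat) \<Rightarrow> (nat \<Rightarrow> bool) \<Rightarrow> bool" where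
  "phi_H m TV TE r \<sigma> \<longleftrightarrow>
     (\<forall>i j. adjacent_trees m TV TE r i j \<longrightarrow> (\<exists>w \<in> Ppath_vertices TE r i j. \<sigma> w))"

text \<open>Multigraph: node set N, edge set Ed, tail/head maps, optional literal labels
  (literal = (variable, polarity)), source s, sink t.\<close>

fun dpath :: "('e \<Rightarrow> 'n) \<Rightarrow> ('e \<Rightarrow> 'n) \<Rightarrow> 'e list \<Rightarrow> 'n \<Rightarrow> 'n \<Rightarrow> bool" where
  "dpath src tgt [] u v \<longleftrightarrow> u = v"
| "dpath src tgt (e # es) u v \<longleftrightarrow> src e = u \<and> dpath src tgt es (tgt e) v"

definition is_nbp :: "'n set \<Rightarrow> 'e set \<Rightarrow> ('e \<Rightarrow> 'n) \<Rightarrow> ('e \<Rightarrow> 'n) \<Rightarrow> 'n \<Rightarrow> 'n \<Rightarrow> bool" where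
  "is_nbp N Ed src tgt s t \<longleftrightarrow> finite N \<and> finite Ed \<and>
     (\<forall>e\<in>Ed. src e \<in> N \<and> tgt e \<in> N) \<and>
     (\<forall>es u. set es \<subseteq> Ed \<longrightarrow> es \<noteq> [] \<longrightarrow> \<not> dpath src tgt es u u) \<and>
     s \<in> N \<and> t \<in> N \<and>
     (\<forall>v\<in>N. (\<not>(\<exists>e\<in>Ed. tgt e = v)) \<longleftrightarrow> v = s) \<and>
     (\<forall>v\<in>N. (\<not>(\<exists>e\<in>Ed. src e = v)) \<longleftrightarrow> v = t)"

definition st_path :: "'e set \<Rightarrow> ('e \<Rightarrow> 'n) \<Rightarrow> ('e \<Rightarrow> 'n) \<Rightarrow> 'n \<Rightarrow> 'n \<Rightarrow> 'e list \<Rightarrow> bool" where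
  "st_path Ed src tgt s t es \<longleftrightarrow> set es \<subseteq> Ed \<and> dpath src tgt es s t"

definition path_lits :: "('e \<Rightarrow> ('v \<times> bool) option) \<Rightarrow> 'e list \<Rightarrow> ('v \<times> bool) set" where
  "path_lits lab es = {l. \<exists>e \<in> set es. lab e = Some l}"

definition computational :: "('e \<Rightarrow> ('v \<times> bool) option) \<Rightarrow> 'e list \<Rightarrow> bool" where
  "computational lab es \<longleftrightarrow> \<not> (\<exists>x. (x, True) \<in> path_lits lab es \<and> (x, False) \<in> path_lits lab es)"

definition nbp_vars :: "'e set \<Rightarrow> ('e \<Rightarrow> ('v \<times> bool) option) \<Rightarrow> 'v set" where
  "nbp_vars Ed lab = {x. \<exists>e\<in>Ed. \<exists>b. lab e = Some (x, b)}"

definition nbp_computes ::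
  "'n set \<Rightarrow> 'e set \<Rightarrow> ('e \<Rightarrow> 'n) \<Rightarrow> ('e \<Rightarrow> 'n) \<Rightarrow> ('e \<Rightarrow> ('v \<times> bool) option) \<Rightarrow> 'n \<Rightarrow> 'n
    \<Rightarrow> 'v set \<Rightarrow> (('v \<Rightarrow> bool) \<Rightarrow> bool) \<Rightarrow> bool" where
  "nbp_computes N Ed src tgt lab s t X f \<longleftrightarrow> nbp_vars Ed lab = X \<and>
     (\<forall>\<sigma>. f \<sigma> \<longleftrightarrow> (\<exists>es. st_path Ed src tgt s t es \<and> computational lab es \<and>
                     (\<forall>(x, b) \<in> path_lits lab es. \<sigma> x = b)))"

definition uniform_read :: "'n set \<Rightarrow> 'e set \<Rightarrow> ('e \<Rightarrow> 'n) \<Rightarrow> ('e \<Rightarrow> 'n) \<Rightarrow> ('e \<Rightarrow> ('v \<times> bool) option)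
    \<Rightarrow> 'n \<Rightarrow> 'n \<Rightarrow> nat \<Rightarrow> bool" where
  "uniform_read N Ed src tgt lab s t d \<longleftrightarrow> is_nbp N Ed src tgt s t \<and>
     (\<forall>es. st_path Ed src tgt s t es \<longrightarrow> (\<forall>x \<in> nbp_vars Ed lab.
        length (filter (\<lambda>e. \<exists>b. lab e = Some (x, b)) es) = d))"

end

theory Submission
  imports Defs "HOL-Library.FuncSet" "HOL-Real_Asymp.Real_Asymp"
begin

text \<open>Only the roots of the trees and the leaves matter; all other variables are set to false. The expansion
  of the graph yields a small set \<open>Y\<close> of pseudoedges that meets every pair of disjoint sets of \<open>q\<close> roots. Setting
  exactly the leaves of the pseudoedges in \<open>Y\<close> to false turns the CNF into the requirement that the set of roots
  set to false is independent in \<open>Y\<close>. A root is set to false with probability \<open>1 / K\<close>, encoded as the zero set of a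
  function from the roots to \<open>{..<K}\<close>; as \<open>2 * card Y \<le> K ^ 2\<close>, at least half of these functions satisfy the CNF.

  An accepted path is cut into \<open>4 * d ^ 2\<close> segments with few root readings each, and averaging gives a set \<open>A\<close> of
  segments such that many roots (\<open>U\<close>) are read only inside \<open>A\<close> and many (\<open>W\<close>) only outside. By uniformity
  \<open>U\<close> and \<open>W\<close> depend only on \<open>A\<close> and the nodes between the segments. Paths with the same such trace can be spliced,
  so once the other roots are fixed, the roots of \<open>U\<close> that are ever false and the roots of \<open>W\<close> that are ever false
  span no pair in \<open>Y\<close>; hence at least \<open>q\<close> roots are always true, which has probability at most
  \<open>(1 - 1 / K) ^ q\<close>. The number of traces is therefore exponential in \<open>q / K\<close>.\<close>

section \<open>Rooted trees\<close>

lemma upath_rev: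
  assumes "upath E p u v"
  shows "upath E (rev p) v u"
proof -
  have "{rev p ! k, rev p ! (k + 1)} \<in> E" if k: "k + 1 < length p" for k
  proof -
    define j where "j = length p - 2 - k"
    have j: "j + 1 < length p" "length p - Suc k = j + 1" "length p - Suc (k + 1) = j"
      using k unfolding j_def by auto
    have "{p ! j, p ! (j + 1)} \<in> E" using assms j(1) unfolding upath_def by blast
    moreover have "rev p ! k = p ! (j + 1)" using k j(2) by (simp add: rev_nth)
    moreover have "rev p ! (k + 1) = p ! j" using k j(3) by (simp add: rev_nth)
    ultimately show ?thesis by (simp add: insert_commute)
  qed
  then show ?thesis using assms unfolding upath_def by (simp add: hd_rev last_rev)
qed

lemma upath_vertices:
  assumes "upath E p u v" "\<And>e. e \<in> E \<Longrightarrow> e \<subseteq> V" "u \<in> V"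
  shows "set p \<subseteq> V"
proof
  fix w assume "w \<in> set p"
  then obtain k where k: "k < length p" "w = p ! k" by (metis in_set_conv_nth)
  show "w \<in> V"
  proof (cases k)
    case 0
    then show ?thesis using assms k unfolding upath_def by (metis hd_conv_nth)
  next
    case (Suc j)
    then have "{p ! j, p ! k} \<in> E" using assms(1) k unfolding upath_def by (metis Suc_eq_plus1)
    then show ?thesis using assms(2) k by blast
  qed
qed

lemma upath_take:
  assumes "upath E p u v" "k < length p"
  shows "upath E (take (Suc k) p) u (p ! k)"
proof -
  have "last (take (Suc k) p) = p ! k" using assms(2) by (simp add: take_Suc_conv_app_nth)
  then show ?thesis using assms unfolding upath_def by auto
qed

lemma upath_Snoc:
  assumes "upath E p u v" "{v, w} \<in> E" "w \<notin> set p"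
  shows "upath E (p @ [w]) u w"
  unfolding upath_def
proof (intro conjI allI impI)
  fix k assume "k + 1 < length (p @ [w])"
  then consider "k + 1 < length p" | "k + 1 = length p" by force
  then show "{(p @ [w]) ! k, (p @ [w]) ! (k + 1)} \<in> E"
  proof cases
    case 2
    then have "p ! k = v" using assms(1) unfolding upath_def by (metis add_diff_cancel_right' last_conv_nth)
    then show ?thesis using 2 assms(2) by (auto simp: nth_append)
  qed (use assms(1) in \<open>auto simp: upath_def nth_append\<close>)
qed (use assms in \<open>auto simp: upath_def\<close>)

lemma upath_length_ge_2:
  assumes "upath E p u v" "u \<noteq> v"
  shows "2 \<le> length p"
  using assms unfolding upath_def by (cases p; cases "tl p") auto

lemma upath_last_nth:
  assumes "upath E p u v"
  shows "p ! (length p - 1) = v"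
  using assms unfolding upath_def by (metis last_conv_nth)

text \<open>The parent function and a height that drops towards the root replace the path-based
  definitions: acyclicity becomes the inequality \<open>ht_par\<close>, and every edge has a known
  upper end.\<close>

locale parent_tree =
  fixes V :: "'v set" and E :: "'v set set" and r :: 'v
    and par :: "'v \<Rightarrow> 'v" and ht :: "'v \<Rightarrow> nat"
  assumes tree: "rooted_tree V E r"
    and edges: "E = (\<lambda>v. {v, par v}) ` (V - {r})"
    and ht_par: "\<And>v. v \<in> V - {r} \<Longrightarrow> ht (par v) < ht v"

text \<open>Let \<open>ht\<close> be the number of vertices on a shortest path from the root. The
  last but one vertex of such a path is a lower neighbour and serves as the parent. The edges to the
  parents are pairwise distinct, as two vertices cannot be parents of each other, so there are
  \<open>card V - 1\<close> of them. By the edge count in \<open>is_tree\<close> no other edge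
  exists.\<close>

lemma rooted_tree_parent:
  assumes "rooted_tree V E r"
  obtains par ht where "parent_tree V E r par ht"
proof -
  have fin: "finite V" and r: "r \<in> V" and cardE: "card E + 1 = card V"
    and Esub: "E \<subseteq> {{u, w} | u w. u \<in> V \<and> w \<in> V \<and> u \<noteq> w}"
    and conn: "\<And>w. w \<in> V \<Longrightarrow> \<exists>p. upath E p r w"
    using assms unfolding rooted_tree_def is_tree_def by blast+
  define ht where "ht v = (LEAST k. \<exists>p. upath E p r v \<and> length p = k)" for v
  have ht_le: "ht v \<le> length p" if "upath E p r v" for p v
    unfolding ht_def using that by (intro Least_le) auto
  have ex: "\<exists>w. w \<in> V \<and> {v, w} \<in> E \<and> ht w < ht v" if v: "v \<in> V - {r}" for v
  proof -
    have "\<exists>p. upath E p r v \<and> length p = ht v"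
      unfolding ht_def using conn v by (intro LeastI_ex[of "\<lambda>k. \<exists>p. upath E p r v \<and> length p = k"]) auto
    then obtain p where p: "upath E p r v" "length p = ht v" by auto
    have len: "length p \<ge> 2" using upath_length_ge_2[OF p(1)] v by auto
    let ?k = "length p - 2"
    have k: "?k + 1 < length p" using len by simp
    have up: "upath E (take (Suc ?k) p) r (p ! ?k)" using upath_take[OF p(1)] k by simp
    have "ht (p ! ?k) < ht v" using ht_le[OF up] p(2) k by simp
    moreover have "{p ! ?k, p ! (?k + 1)} \<in> E" using p(1) k unfolding upath_def by blast
    moreover have "?k + 1 = length p - 1" using len by simp
    then have "p ! (?k + 1) = v" using upath_last_nth[OF p(1)] by simp
    ultimately have "{p ! ?k, v} \<in> E" "ht (p ! ?k) < ht v" by auto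
    moreover have "p ! ?k \<in> V" using \<open>{p ! ?k, v} \<in> E\<close> Esub by (auto simp: doubleton_eq_iff dest!: subsetD)
    ultimately show ?thesis by (metis insert_commute)
  qed
  then have "\<forall>v\<in>V - {r}. \<exists>w. w \<in> V \<and> {v, w} \<in> E \<and> ht w < ht v" by blast
  from bchoice[OF this] obtain par
    where par: "\<And>v. v \<in> V - {r} \<Longrightarrow> par v \<in> V \<and> {v, par v} \<in> E \<and> ht (par v) < ht v" by blast
  let ?f = "\<lambda>v. {v, par v}"
  have "inj_on ?f (V - {r})"
  proof (rule inj_onI)
    fix v w assume vw: "v \<in> V - {r}" "w \<in> V - {r}" "{v, par v} = {w, par w}"
    then have "v = w \<or> v = par w \<and> w = par v" unfolding doubleton_eq_iff by metis
    then show "v = w" using par[OF vw(1)] par[OF vw(2)] by (metis less_asym)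
  qed
  then have "card (?f ` (V - {r})) = card E" using cardE r fin by (simp add: card_image)
  moreover have "?f ` (V - {r}) \<subseteq> E" using par by auto
  moreover have "E \<subseteq> Pow V" using Esub by auto
  then have "finite E" using fin by (meson finite_Pow_iff finite_subset)
  ultimately have "?f ` (V - {r}) = E" by (intro card_subset_eq)
  note eq = this[symmetric]
  have "parent_tree V E r par ht"
  proof (rule parent_tree.intro)
    show "rooted_tree V E r" by (rule assms)
    show "E = (\<lambda>v. {v, par v}) ` (V - {r})" by (rule eq)
    show "ht (par v) < ht v" if "v \<in> V - {r}" for v using par[OF that] by simp
  qed
  then show ?thesis by (rule that)
qed

context parent_tree
begin

lemma finV: "finite V" and root_in: "r \<in> V"
  and edge_subset: "e \<in> E \<Longrightarrow> e \<subseteq> V"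
  and path_ex: "w \<in> V \<Longrightarrow> \<exists>p. upath E p r w"
  using tree unfolding rooted_tree_def is_tree_def by auto

lemma edge_cases:
  assumes "{u, w} \<in> E"
  shows "u \<in> V - {r} \<and> w = par u \<or> w \<in> V - {r} \<and> u = par w"
  using assms edges by (auto simp: doubleton_eq_iff)

text \<open>A path that starts at the root can only descend: the root has no parent to go to, and
  after a descending step the parent has already been visited.\<close>

lemma path_par:
  assumes p: "upath E p r w" and k: "Suc k < length p"
  shows "p ! Suc k \<in> V - {r} \<and> par (p ! Suc k) = p ! k"
  using k
proof (induction k)
  case 0
  have "p ! 0 = r" using p unfolding upath_def by (metis hd_conv_nth)
  moreover have "{p ! 0, p ! Suc 0} \<in> E" using p 0 unfolding upath_def by (metis Suc_eq_plus1)
  ultimately show ?case using edge_cases by fastforce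
next
  case (Suc k)
  have "{p ! Suc k, p ! Suc (Suc k)} \<in> E" using p Suc.prems unfolding upath_def by (metis Suc_eq_plus1)
  moreover have "p ! Suc (Suc k) \<noteq> p ! k"
    using p Suc.prems unfolding upath_def by (simp add: nth_eq_iff_index_eq)
  ultimately show ?case using edge_cases Suc by fastforce
qed

lemma path_ht:
  assumes p: "upath E p r w" and "i < j" "j < length p"
  shows "ht (p ! i) < ht (p ! j)"
  using assms(2,3)
proof (induction j)
  case (Suc j)
  have "ht (p ! j) < ht (p ! Suc j)" using path_par[OF p Suc.prems(2)] ht_par by metis
  then show ?case using Suc by (cases "i = j") auto
qed simp

lemma path_ht_le:
  assumes p: "upath E p r w" and v: "v \<in> set p"
  shows "ht v \<le> ht w"
proof -
  obtain i where i: "i < length p" "v = p ! i" using v by (metis in_set_conv_nth)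
  have "w = p ! (length p - 1)" using p unfolding upath_def by (metis last_conv_nth)
  then show ?thesis using path_ht[OF p, of i "length p - 1"] i
    by (cases "i = length p - 1") (auto intro!: less_imp_le)
qed

text \<open>Heights increase along a path from the root, so a neighbour on the path from
  \<open>u\<close> to the root cannot lie above \<open>u\<close> in height and must be its
  parent.\<close>

lemma children_eq: "children E r p = {u \<in> V - {r}. par u = p}"
proof (intro set_eqI iffI)
  fix u assume "u \<in> children E r p"
  then obtain q where q: "{p, u} \<in> E" "upath E q u r" "p \<in> set q" unfolding children_def by auto
  have "ht p \<le> ht u" using path_ht_le[OF upath_rev[OF q(2)]] q(3) by simp
  then show "u \<in> {u \<in> V - {r}. par u = p}" using edge_cases[OF q(1)] ht_par by fastforce
next
  fix u assume u: "u \<in> {u \<in> V - {r}. par u = p}"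
  then have e: "{p, u} \<in> E" using edges by auto
  obtain q where q: "upath E q r u" using path_ex u by auto
  have len: "Suc (length q - 2) < length q" "Suc (length q - 2) = length q - 1"
    using upath_length_ge_2[OF q] u by auto
  have "p = q ! (length q - 2)" using path_par[OF q len(1)] u upath_last_nth[OF q] len(2) by auto
  then have "p \<in> set q" using len by simp
  then show "u \<in> children E r p" unfolding children_def
    using e upath_rev[OF q] by (auto intro!: exI[of _ "rev q"])
qed

lemma leaf_edge:
  assumes "l \<in> tree_leaves V E r" "{l, u} \<in> E"
  shows "l \<in> V - {r} \<and> u = par l"
  using assms edge_cases[OF assms(2)] unfolding tree_leaves_def children_eq by auto

lemma root_leaf:
  assumes "r \<in> tree_leaves V E r"
  shows "V = {r}"
proof (rule ccontr)
  assume "V \<noteq> {r}"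
  then obtain u where u: "u \<in> V" "u \<noteq> r" using root_in by auto
  obtain q where q: "upath E q r u" using path_ex u by auto
  have ne: "q \<noteq> []" "hd q = r" "last q = u" using q unfolding upath_def by auto
  have "Suc 0 < length q" using ne u(2) by (cases q; cases "tl q") auto
  then have "{q ! 0, q ! 1} \<in> E" using q unfolding upath_def by auto
  then show False using leaf_edge assms ne by (metis DiffE hd_conv_nth singletonI)
qed

lemma path_funpow:
  assumes p: "upath E p r w" and k: "k < length p"
  shows "p ! (length p - Suc k) = (par ^^ k) w"
  using k
proof (induction k)
  case 0
  then show ?case using upath_last_nth[OF p] by simp
next
  case (Suc k)
  have "Suc (length p - Suc (Suc k)) = length p - Suc k" using Suc.prems by simp
  then show ?case using Suc path_par[OF p, of "length p - Suc (Suc k)"] by simp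
qed

text \<open>Among the vertices whose path from the root passes through \<open>v\<close>, one of
  maximal height is a leaf, since a child would extend the path. Hence a leaf and a number of parent
  steps determine \<open>v\<close>, which is how \<open>card_HV\<close> counts vertices.\<close>

lemma below_leaf:
  assumes v: "v \<in> V"
  obtains l p k where "l \<in> tree_leaves V E r" "upath E p r l" "k < length p" "v = (par ^^ k) l"
proof -
  define D where "D = {w \<in> V. \<exists>p. upath E p r w \<and> v \<in> set p}"
  have "v \<in> D" using v path_ex[OF v] unfolding D_def upath_def by (auto intro: last_in_set)
  moreover have finD: "finite (ht ` D)" using finV unfolding D_def by simp
  ultimately have "Max (ht ` D) \<in> ht ` D" by (intro Max_in) auto
  then obtain l where l0: "l \<in> D" "ht l = Max (ht ` D)" by force
  then have l: "l \<in> D" "\<And>w. w \<in> D \<Longrightarrow> ht w \<le> ht l" using finD by auto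
  then obtain p where p: "upath E p r l" "v \<in> set p" unfolding D_def by auto
  have "children E r l = {}"
  proof (rule ccontr)
    assume "children E r l \<noteq> {}"
    then obtain u where u: "u \<in> V - {r}" "par u = l" unfolding children_eq by auto
    have gt: "ht l < ht u" using ht_par u by auto
    then have "u \<notin> set p" using path_ht_le[OF p(1)] by (meson linorder_not_le)
    moreover have "{l, u} \<in> E" using u edges by auto
    ultimately have "upath E (p @ [u]) r u" using upath_Snoc p(1) by metis
    then have "u \<in> D" using u p(2) unfolding D_def by auto
    then show False using l(2) gt by fastforce
  qed
  then have leaf: "l \<in> tree_leaves V E r" using l(1) unfolding tree_leaves_def D_def by auto
  obtain i where i: "i < length p" "v = p ! i" using p(2) by (metis in_set_conv_nth)
  let ?k = "length p - Suc i"
  have "length p - Suc ?k = i" "?k < length p" using i by auto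
  then have "v = (par ^^ ?k) l" using path_funpow[OF p(1), of ?k] i by simp
  then show ?thesis using that[OF leaf p(1)] \<open>?k < length p\<close> by blast
qed

end

section \<open>Binary tree based graphs\<close>

locale btb =
  fixes m :: nat and TV :: "nat \<Rightarrow> nat set" and TE :: "nat \<Rightarrow> nat set set" and r :: "nat \<Rightarrow> nat"
  assumes graph: "btb_graph m TV TE r"
begin

definition leaves :: "nat \<Rightarrow> nat set" where
  "leaves i = tree_leaves (TV i) (TE i) (r i)"

text \<open>A one-vertex tree has its root as its leaf; \<open>big\<close> collects the other trees, whose roots
  can be set independently of the leaves.\<close>
definition big :: "nat set" where
  "big = {i. i < m \<and> r i \<notin> leaves i}"

lemma parent_tree_at:
  assumes "i < m"
  obtains par ht where "parent_tree (TV i) (TE i) (r i) par ht"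
  using graph assms rooted_tree_parent unfolding btb_graph_def extended_tree_def by metis

lemma inj_r: "inj_on r {..<m}"
  using graph unfolding btb_graph_def by auto

lemma root_in_tree: "i < m \<Longrightarrow> r i \<in> TV i"
  and finite_tree: "i < m \<Longrightarrow> finite (TV i)"
  and tree_edge_subset: "i < m \<Longrightarrow> e \<in> TE i \<Longrightarrow> e \<subseteq> TV i"
  and tree_path_ex: "i < m \<Longrightarrow> w \<in> TV i \<Longrightarrow> \<exists>p. upath (TE i) p (r i) w"
  by (metis parent_tree_at parent_tree.root_in, metis parent_tree_at parent_tree.finV,
      metis parent_tree_at parent_tree.edge_subset, metis parent_tree_at parent_tree.path_ex)

lemma leaves_subset: "leaves i \<subseteq> TV i"
  unfolding leaves_def tree_leaves_def by auto

lemma HLeaves_iff: "v \<in> HLeaves m TV TE r \<longleftrightarrow> (\<exists>i<m. v \<in> leaves i)"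
  unfolding HLeaves_def leaves_def by auto

lemma shared_leaf:
  assumes "i < m" "j < m" "i \<noteq> j" "v \<in> TV i" "v \<in> TV j"
  shows "v \<in> leaves i" "v \<in> leaves j"
  using graph assms unfolding btb_graph_def leaves_def by blast+

lemma shared_unique:
  assumes "i < m" "j < m" "i \<noteq> j" "v \<in> TV i" "v \<in> TV j" "w \<in> TV i" "w \<in> TV j"
  shows "v = w"
proof -
  have "card (TV i \<inter> TV j) \<le> 1" using graph assms unfolding btb_graph_def by blast
  moreover have "finite (TV i \<inter> TV j)" using finite_tree assms by auto
  ultimately show ?thesis using assms by (metis IntI One_nat_def card_le_Suc0_iff_eq)
qed

lemma leaf_trees:
  assumes "i < m" "l \<in> leaves i"
  obtains j where "j \<noteq> i" "{k. k < m \<and> l \<in> leaves k} = {i, j}"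
proof -
  have "card {k. k < m \<and> l \<in> leaves k} = 2"
    using graph assms unfolding btb_graph_def leaves_def HLeaves_def by blast
  then obtain a b where "{k. k < m \<and> l \<in> leaves k} = {a, b}" "a \<noteq> b" by (auto simp: card_2_iff)
  moreover have "i \<in> {k. k < m \<and> l \<in> leaves k}" using assms by auto
  ultimately show ?thesis using that[of b] that[of a] by (cases "i = a") (auto simp: insert_commute)
qed

lemma leaf_trees_unique:
  assumes "i < m" "j < m" "k < m" "i \<noteq> j" "l \<in> leaves i" "l \<in> leaves j" "l \<in> leaves k"
  shows "k = i \<or> k = j"
proof -
  obtain h where h: "{k. k < m \<and> l \<in> leaves k} = {i, h}" using leaf_trees[OF assms(1,5)] .
  have "j \<in> {k. k < m \<and> l \<in> leaves k}" "k \<in> {k. k < m \<and> l \<in> leaves k}" using assms by auto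
  then show ?thesis unfolding h using assms(4) by auto
qed

lemma adjacent_iff:
  "adjacent_trees m TV TE r i j \<longleftrightarrow> i < m \<and> j < m \<and> i \<noteq> j \<and> (\<exists>l. l \<in> leaves i \<and> l \<in> leaves j)"
  unfolding adjacent_trees_def leaves_def by auto

text \<open>Every leaf also belongs to a second tree, and two trees share at most one vertex, so
  mapping a leaf to its second tree is injective.\<close>

lemma card_leaves:
  assumes i: "i < m"
  shows "card (leaves i) \<le> m"
proof -
  have "\<exists>j. j < m \<and> j \<noteq> i \<and> l \<in> leaves j" if "l \<in> leaves i" for l
    using leaf_trees[OF i that] by (metis (mono_tags, lifting) insertI1 insertI2 mem_Collect_eq)
  then obtain f where f: "\<And>l. l \<in> leaves i \<Longrightarrow> f l < m \<and> f l \<noteq> i \<and> l \<in> leaves (f l)" by metis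
  have "inj_on f (leaves i)"
  proof (rule inj_onI)
    fix l l' assume "l \<in> leaves i" "l' \<in> leaves i" "f l = f l'"
    then show "l = l'" using shared_unique[of i "f l" l l'] f i leaves_subset by (metis subsetD)
  qed
  then have "card (leaves i) \<le> card {..<m}" using f by (intro card_inj_on_le[of f]) auto
  then show ?thesis by simp
qed

text \<open>A vertex is determined by its tree, a leaf below it and its distance from that leaf. A
  polynomial bound is enough, because it only shifts the final exponents by a constant
  factor.\<close>

lemma card_HV:
  assumes "tree_height_ok m TV TE r" "1 \<le> m"
  shows "card (HV m TV) \<le> 4 * m ^ 3"
proof -
  have "\<exists>par. \<forall>v\<in>TV i. \<exists>l\<in>leaves i. \<exists>k<m + 3. v = (par ^^ k) l" if i: "i < m" for i
  proof -
    obtain par ht where "parent_tree (TV i) (TE i) (r i) par ht" using parent_tree_at[OF i] .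
    then interpret parent_tree "TV i" "TE i" "r i" par ht .
    have "\<exists>l\<in>leaves i. \<exists>k<m + 3. v = (par ^^ k) l" if v: "v \<in> TV i" for v
    proof -
      obtain l p k where l: "l \<in> tree_leaves (TV i) (TE i) (r i)" "upath (TE i) p (r i) l"
        "k < length p" "v = (par ^^ k) l" using below_leaf[OF v] .
      have "real (length p) \<le> log 2 (real m) / 4.9 + 3"
        using assms(1) i l unfolding tree_height_ok_def by blast
      \<comment> \<open>The logarithmic height bound is relaxed to the linear one
        \<open>m + 3\<close>.\<close>
      moreover have "log 2 (real m) \<le> log 2 (2 ^ m)"
        using assms(2) of_nat_less_two_power[of m, where 'a = real] by (intro log_le_cancel_iff[THEN iffD2]) auto
      then have "log 2 (real m) \<le> m" by (simp add: log_nat_power)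
      moreover have "0 \<le> log 2 (real m)" using assms(2) by simp
      ultimately have "real (length p) \<le> m + 3" by simp
      then show ?thesis using l unfolding leaves_def by (intro bexI[of _ l] exI[of _ k]) auto
    qed
    then show ?thesis by blast
  qed
  then obtain par where par: "\<And>i v. i < m \<Longrightarrow> v \<in> TV i \<Longrightarrow> \<exists>l\<in>leaves i. \<exists>k<m + 3. v = (par i ^^ k) l"
    by metis
  let ?X = "\<lambda>i. (\<lambda>(l, k). (par i ^^ k) l) ` (leaves i \<times> {..<m + 3})"
  have fin: "finite (leaves i)" if "i < m" for i using that finite_tree leaves_subset finite_subset by blast
  have "TV i \<subseteq> ?X i" if "i < m" for i using par[OF that] by force
  then have "HV m TV \<subseteq> (\<Union>i<m. ?X i)" unfolding HV_def by blast
  then have "card (HV m TV) \<le> card (\<Union>i<m. ?X i)" using fin by (intro card_mono) auto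
  also have "\<dots> \<le> (\<Sum>i<m. card (?X i))" by (intro card_UN_le) auto
  also have "\<dots> \<le> (\<Sum>i<m. m * (m + 3))"
  proof (intro sum_mono)
    fix i assume i: "i \<in> {..<m}"
    have "card (?X i) \<le> card (leaves i \<times> {..<m + 3})" using fin i by (intro card_image_le) auto
    also have "\<dots> \<le> m * (m + 3)" using card_leaves i by (simp add: card_cartesian_product)
    finally show "card (?X i) \<le> m * (m + 3)" .
  qed
  also have "\<dots> = m * (m * (m + 3))" by simp
  also have "\<dots> \<le> m * (m * (4 * m))" using assms(2) by (intro mult_le_mono) auto
  also have "\<dots> = 4 * m ^ 3" by (simp add: power3_eq_cube)
  finally show ?thesis .
qed

section \<open>One-vertex trees and the clauses of the CNF\<close>

lemma small_tree:
  assumes "i < m" "i \<notin> big"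
  shows "TV i = {r i}" "leaves i = {r i}"
proof -
  have "r i \<in> leaves i" using assms unfolding big_def by auto
  moreover show "TV i = {r i}"
    using calculation parent_tree_at[OF assms(1)] parent_tree.root_leaf unfolding leaves_def by metis
  ultimately show "leaves i = {r i}" using leaves_subset by auto
qed

text \<open>The only vertex of such a tree is the leaf that it shares with all its neighbours, and a
  leaf lies in exactly two trees.\<close>

lemma small_tree_adjacent_unique:
  assumes "i < m" "i \<notin> big" "adjacent_trees m TV TE r i j" "adjacent_trees m TV TE r i k"
  shows "j = k"
proof -
  have l: "r i \<in> leaves i" "r i \<in> leaves j" "r i \<in> leaves k" "j < m" "k < m" "j \<noteq> i" "k \<noteq> i"
    using assms small_tree unfolding adjacent_iff by auto
  then show ?thesis using leaf_trees_unique[of i j k "r i"] assms(1) by auto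
qed

lemma big_root_not_leaf:
  assumes "i \<in> big" "j < m"
  shows "r i \<notin> leaves j"
proof
  assume a: "r i \<in> leaves j"
  have "r i \<in> TV i" "i < m" "r i \<notin> leaves i" using assms root_in_tree unfolding big_def by auto
  moreover have "r i \<in> TV j" using a leaves_subset by auto
  ultimately show False using a shared_leaf[of i j] assms(2) by (cases "i = j") auto
qed

text \<open>The two root-leaf paths meet only in \<open>l\<close>, because the trees have no other
  common vertex, so they join to a path without repetition. As \<open>Ppath_vertices\<close>
  collects the vertices of all paths between the roots, exhibiting one suffices.\<close>

lemma Ppath_ends_leaf:
  assumes "i < m" "j < m" "i \<noteq> j" "l \<in> leaves i" "l \<in> leaves j"
  shows "{r i, r j, l} \<subseteq> Ppath_vertices TE r i j"
proof -
  have l: "l \<in> TV i" "l \<in> TV j" using assms leaves_subset by auto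
  obtain p where p: "upath (TE i) p (r i) l" using tree_path_ex assms l by blast
  obtain p' where p': "upath (TE j) p' (r j) l" using tree_path_ex assms l by blast
  let ?q = "rev p'"
  have q: "upath (TE j) ?q l (r j)" using upath_rev[OF p'] .
  have pV: "set p \<subseteq> TV i" using upath_vertices[OF p] tree_edge_subset root_in_tree assms by blast
  have qV: "set ?q \<subseteq> TV j" using upath_vertices[OF q] tree_edge_subset l assms by blast
  have qc: "?q = l # tl ?q" using q unfolding upath_def by (metis list.collapse)
  have dq: "distinct ?q" using q unfolding upath_def by blast
  have "l \<notin> set (tl ?q)" using dq qc by (metis distinct.simps(2))
  moreover have "set (tl ?q) \<subseteq> TV j" using qV by (metis qc order_trans set_subset_Cons)
  ultimately have disj: "set p \<inter> set (tl ?q) = {}"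
    using pV shared_unique[OF assms(1-3)] l by blast
  let ?P = "p @ tl ?q"
  have pe: "p \<noteq> []" "hd p = r i" "last p = l" "distinct p" using p unfolding upath_def by auto
  \<comment> \<open>The second way of splitting assigns \<open>l\<close> to \<open>?q\<close>, so
    that the edge leaving \<open>l\<close> is seen as an edge of the second tree.\<close>
  have Psplit: "?P = butlast p @ ?q" using pe qc
    by (metis append.assoc append_Cons append_Nil append_butlast_last_id)
  have "upath (TE i \<union> TE j) ?P (r i) (r j)"
    unfolding upath_def
  proof (intro conjI allI impI)
    show "last ?P = r j" unfolding Psplit using q unfolding upath_def by simp
    show "distinct ?P" using pe disj dq by (simp add: distinct_tl)
    fix k assume k: "k + 1 < length ?P"
    show "{?P ! k, ?P ! (k + 1)} \<in> TE i \<union> TE j"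
    proof (cases "k + 1 < length p")
      case True
      then show ?thesis using p unfolding upath_def by (simp add: nth_append)
    next
      case False
      let ?b = "length (butlast p)"
      have kb: "?b \<le> k" "(k - ?b) + 1 < length ?q"
        using False k pe arg_cong[OF Psplit, of length] by auto
      have "?P ! k = ?q ! (k - ?b)" "?P ! (k + 1) = ?q ! ((k - ?b) + 1)"
        unfolding Psplit using kb by (simp_all add: nth_append Suc_diff_le del: length_butlast)
      then show ?thesis using q kb unfolding upath_def by auto
    qed
  qed (use pe in auto)
  moreover have "r i \<in> set ?P" "r j \<in> set ?P" "l \<in> set ?P"
  proof -
    show "r i \<in> set ?P" using pe(1,2) hd_in_set[of p] by simp
    show "l \<in> set ?P" using pe(1,3) last_in_set[of p] by simp
    have "r j \<in> set ?q" using q last_in_set[of ?q] unfolding upath_def by simp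
    then show "r j \<in> set ?P" unfolding Psplit by simp
  qed
  ultimately show ?thesis unfolding Ppath_vertices_def by blast
qed

lemma leaf_neighbour_unique:
  assumes "i < m" "l \<in> leaves i" "{l, u} \<in> TE i" "{l, w} \<in> TE i"
  shows "u = w"
  using parent_tree_at[OF assms(1)] assms parent_tree.leaf_edge unfolding leaves_def by metis

text \<open>An inner vertex of the path has two different neighbours on it. A leaf has just one edge
  in its own tree, and a vertex other than \<open>l\<close> lies in only one of the two trees, so it
  cannot obtain its second edge from the other tree.\<close>

lemma Ppath_no_other_leaf:
  assumes ij: "i < m" "j < m" "i \<noteq> j" "l \<in> leaves i" "l \<in> leaves j"
    and w: "w \<in> Ppath_vertices TE r i j" "w \<noteq> r i" "w \<noteq> r j" "w \<noteq> l"
  shows "w \<in> TV i \<union> TV j" "w \<notin> HLeaves m TV TE r"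
proof -
  obtain p where p: "upath (TE i \<union> TE j) p (r i) (r j)" "w \<in> set p"
    using w(1) unfolding Ppath_vertices_def by auto
  obtain a where a: "a < length p" "w = p ! a" using p(2) by (metis in_set_conv_nth)
  have "a \<noteq> 0" using a w(2) p(1) unfolding upath_def by (metis hd_conv_nth)
  moreover have "a \<noteq> length p - 1" using a w(3) upath_last_nth[OF p(1)] by auto
  ultimately obtain b where b: "a = b + 1" "b + 1 + 1 < length p" using a
    by (metis One_nat_def Suc_eq_plus1 Suc_lessI diff_Suc_1 not0_implies_Suc)
  have e1: "{w, p ! b} \<in> TE i \<union> TE j" using p(1) b a unfolding upath_def by (metis add_lessD1 insert_commute)
  have e2: "{w, p ! (b + 1 + 1)} \<in> TE i \<union> TE j" using p(1) b a unfolding upath_def by blast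
  have ne: "p ! b \<noteq> p ! (b + 1 + 1)" using p(1) b unfolding upath_def by (simp add: nth_eq_iff_index_eq)
  show wV: "w \<in> TV i \<union> TV j" using e1 tree_edge_subset ij by blast
  \<comment> \<open>Here \<open>h\<close> is the one of the two trees that contains
    \<open>w\<close>. If \<open>w\<close> is a leaf of some tree \<open>f\<close>, it is also a leaf
    of \<open>h\<close>, since shared vertices are leaves on both sides.\<close>
  have aux: False if hk: "h < m" "k < m" "h \<noteq> k" "w \<in> TV h" "{h, k} = {i, j}" "w \<in> leaves f" "f < m" for h k f
  proof -
    have wh: "w \<in> leaves h" using hk shared_leaf[of h f w] leaves_subset by (cases "h = f") auto
    have "l \<in> TV h" "l \<in> TV k" using hk(5) ij leaves_subset by (auto simp: doubleton_eq_iff)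
    then have "w \<notin> TV k" using shared_unique[of h k w l] hk w(4) by blast
    then have "{w, u} \<notin> TE k" for u using tree_edge_subset[OF hk(2)] by blast
    moreover have "TE i \<union> TE j = TE h \<union> TE k" using hk(5) by (auto simp: doubleton_eq_iff)
    ultimately have "{w, p ! b} \<in> TE h" "{w, p ! (b + 1 + 1)} \<in> TE h" using e1 e2 by auto
    then show False using leaf_neighbour_unique[OF hk(1) wh] ne by blast
  qed
  show "w \<notin> HLeaves m TV TE r"
  proof
    assume "w \<in> HLeaves m TV TE r"
    then obtain f where "f < m" "w \<in> leaves f" unfolding HLeaves_iff by auto
    then show False using wV aux[of i j f] aux[of j i f] ij by (auto simp: insert_commute)
  qed
qed

text \<open>Non-leaf non-root vertices are switched off, the leaf shared by a pair in \<open>Y\<close> is switched off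
  and all other leaves are switched on: what remains of the clauses is \<open>x\<^sub>i \<or> x\<^sub>j\<close> for \<open>(i, j) \<in> Y\<close>.\<close>
definition asg :: "(nat \<times> nat) set \<Rightarrow> nat set \<Rightarrow> nat \<Rightarrow> bool" where
  "asg Y I x \<longleftrightarrow> (if x \<in> HLeaves m TV TE r then \<not> (\<exists>(i, j)\<in>Y. x \<in> leaves i \<and> x \<in> leaves j)
     else \<exists>i\<in>big. x = r i \<and> i \<notin> I)"

lemma asg_root:
  assumes "i \<in> big"
  shows "asg Y I (r i) \<longleftrightarrow> i \<notin> I"
proof -
  have "r i \<notin> HLeaves m TV TE r" using big_root_not_leaf[OF assms] unfolding HLeaves_iff by blast
  then have "asg Y I (r i) \<longleftrightarrow> (\<exists>k\<in>big. r i = r k \<and> k \<notin> I)" unfolding asg_def by simp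
  moreover have "inj_on r big" using inj_r by (rule inj_on_subset) (auto simp: big_def)
  ultimately show ?thesis using assms inj_onD[of r big] by metis
qed

lemma asg_other: "x \<notin> r ` big \<Longrightarrow> asg Y I x = asg Y J x"
  unfolding asg_def by auto

text \<open>For a pair in \<open>Y\<close> the shared leaf is false, and no other vertex of the path
  except its two ends can be true: a third root on it would be a vertex shared with another tree,
  hence a leaf. Conversely, a false shared leaf comes from a pair in \<open>Y\<close>; a leaf lies
  in only two trees, so that pair is the given one up to order.\<close>

lemma phi_H_asg:
  assumes Y: "Y \<subseteq> {(i, j). i \<in> big \<and> j \<in> big \<and> adjacent_trees m TV TE r i j}"
  shows "phi_H m TV TE r (asg Y I) \<longleftrightarrow> (\<forall>(i, j)\<in>Y. i \<notin> I \<or> j \<notin> I)"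
proof
  assume phi: "phi_H m TV TE r (asg Y I)"
  have "i \<notin> I \<or> j \<notin> I" if ij: "(i, j) \<in> Y" for i j
  proof (rule ccontr)
    assume c: "\<not> (i \<notin> I \<or> j \<notin> I)"
    have big: "i \<in> big" "j \<in> big" and adj: "adjacent_trees m TV TE r i j" using Y ij by auto
    then obtain l where l: "i < m" "j < m" "i \<noteq> j" "l \<in> leaves i" "l \<in> leaves j"
      unfolding adjacent_iff by auto
    obtain w where w: "w \<in> Ppath_vertices TE r i j" "asg Y I w"
      using phi adj unfolding phi_H_def by blast
    have "\<not> asg Y I l" using l ij unfolding asg_def HLeaves_iff by auto
    then have ne: "w \<noteq> r i" "w \<noteq> r j" "w \<noteq> l" using w(2) asg_root big c by auto
    have wV: "w \<in> TV i \<union> TV j" "w \<notin> HLeaves m TV TE r" using Ppath_no_other_leaf[OF l w(1) ne] .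
    then obtain k where k: "k \<in> big" "w = r k" using w(2) unfolding asg_def by auto
    then have km: "k < m" "w \<in> TV k" using root_in_tree unfolding big_def by auto
    have "k \<noteq> i" "k \<noteq> j" using k ne by auto
    then have "w \<in> HLeaves m TV TE r"
      using wV(1) shared_leaf[of i k w] shared_leaf[of j k w] km l unfolding HLeaves_iff by blast
    then show False using wV(2) by simp
  qed
  then show "\<forall>(i, j)\<in>Y. i \<notin> I \<or> j \<notin> I" by auto
next
  assume ind: "\<forall>(i, j)\<in>Y. i \<notin> I \<or> j \<notin> I"
  show "phi_H m TV TE r (asg Y I)"
    unfolding phi_H_def
  proof (intro allI impI)
    fix i j assume "adjacent_trees m TV TE r i j"
    then obtain l where l: "i < m" "j < m" "i \<noteq> j" "l \<in> leaves i" "l \<in> leaves j"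
      unfolding adjacent_iff by auto
    note P = Ppath_ends_leaf[OF l]
    have lH: "l \<in> HLeaves m TV TE r" using l HLeaves_iff by auto
    show "\<exists>w\<in>Ppath_vertices TE r i j. asg Y I w"
    proof (cases "\<exists>(i', j')\<in>Y. l \<in> leaves i' \<and> l \<in> leaves j'")
      case False
      then have "asg Y I l" using lH unfolding asg_def by simp
      then show ?thesis using P by blast
    next
      case True
      then obtain i' j' where Y': "(i', j') \<in> Y" "l \<in> leaves i'" "l \<in> leaves j'" by auto
      then have b: "i' \<in> big" "j' \<in> big" "i' < m" "j' < m" "i' \<noteq> j'" using Y unfolding adjacent_iff by auto
      have "{i', j'} \<subseteq> {i, j}" using leaf_trees_unique[OF l(1,2) _ l(3-5)] b Y' by auto
      moreover have "asg Y I (r i') \<or> asg Y I (r j')" using ind Y' asg_root b by auto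
      ultimately show ?thesis using P by blast
    qed
  qed
qed

end

section \<open>Hitting sets and covers by rectangles\<close>

text \<open>Blocks of \<open>A\<close> elements are split off from \<open>W\<close> one after
  another. Fewer than \<open>A\<close> elements of \<open>U\<close> have no partner in a given
  block, since otherwise \<open>exp\<close> would supply one, so each of the \<open>b\<close>
  disjoint blocks contributes at least \<open>q - A\<close> pairs.\<close>

lemma expander_edges_lower_bound:
  assumes exp: "\<And>U W. U \<subseteq> S \<Longrightarrow> W \<subseteq> S \<Longrightarrow> U \<inter> W = {} \<Longrightarrow> card U = A \<Longrightarrow> card W = A
      \<Longrightarrow> \<exists>i\<in>U. \<exists>j\<in>W. (i, j) \<in> E"
    and S: "finite S" "U \<subseteq> S" "W \<subseteq> S" "U \<inter> W = {}" "q \<le> card U" "b * A \<le> card W"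
  shows "b * (q - A) \<le> card (E \<inter> U \<times> W)"
  using S(3,4,6)
proof (induction b arbitrary: W)
  case (Suc b)
  have fin: "finite U" "finite W" using S Suc.prems finite_subset by blast+
  obtain B where B: "B \<subseteq> W" "card B = A"
    using Suc.prems(3) by (metis add_leD1 mult_Suc obtain_subset_with_card_n)
  have finB: "finite B" using B fin finite_subset by blast
  define N where "N = {i \<in> U. \<exists>j\<in>B. (i, j) \<in> E}"
  have "card (U - N) < A"
  proof (rule ccontr)
    assume "\<not> card (U - N) < A"
    then obtain U' where U': "U' \<subseteq> U - N" "card U' = A" by (metis not_less obtain_subset_with_card_n)
    then have "\<exists>i\<in>U'. \<exists>j\<in>B. (i, j) \<in> E" using exp[of U' B] B S(2) Suc.prems by blast
    then show False using U' unfolding N_def by blast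
  qed
  moreover have "card (U - N) = card U - card N"
    using fin by (intro card_Diff_subset) (auto simp: N_def)
  ultimately have "q - A \<le> card N" using S(5) by linarith
  also have "N = fst ` (E \<inter> U \<times> B)" unfolding N_def by force
  then have "card N \<le> card (E \<inter> U \<times> B)" using fin finB by (simp add: card_image_le)
  finally have 1: "q - A \<le> card (E \<inter> U \<times> B)" .
  have "b * A \<le> card (W - B)" using Suc.prems(3) B finB by (simp add: card_Diff_subset)
  then have 2: "b * (q - A) \<le> card (E \<inter> U \<times> (W - B))" using Suc.prems by (intro Suc.IH) auto
  have "E \<inter> U \<times> W = (E \<inter> U \<times> B) \<union> (E \<inter> U \<times> (W - B))" using B by auto
  then have "card (E \<inter> U \<times> W) = card (E \<inter> U \<times> B) + card (E \<inter> U \<times> (W - B))"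
    using fin finB by (simp only:) (intro card_Un_disjoint, auto)
  then show ?case using 1 2 by simp
qed simp

text \<open>Union bound for a random sample: a list of \<open>t\<close> elements of \<open>E\<close>
  drawn with replacement misses a fixed \<open>B\<close> with probability at most
  \<open>((card E - M) / card E) ^ t\<close>. Lists rather than sets make the draws independent and
  the counts exact powers.\<close>

lemma hitting_set_exists:
  assumes fin: "finite E" "finite \<B>"
    and B: "\<And>B. B \<in> \<B> \<Longrightarrow> B \<subseteq> E \<and> M \<le> card B"
    and lt: "card \<B> * (card E - M) ^ t < card E ^ t"
  obtains Y where "Y \<subseteq> E" "card Y \<le> t" "\<And>B. B \<in> \<B> \<Longrightarrow> Y \<inter> B \<noteq> {}"
proof -
  let ?L = "\<lambda>X. {xs. set xs \<subseteq> X \<and> length xs = t}"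
  have "card (\<Union>B\<in>\<B>. ?L (E - B)) \<le> (\<Sum>B\<in>\<B>. card (?L (E - B)))" using fin(2) by (rule card_UN_le)
  also have "\<dots> \<le> (\<Sum>B\<in>\<B>. (card E - M) ^ t)"
  proof (intro sum_mono)
    fix X assume X: "X \<in> \<B>"
    have "card (E - X) \<le> card E - M" using card_Diff_subset[of X E] B[OF X] fin(1) finite_subset[of X E] by auto
    then show "card (?L (E - X)) \<le> (card E - M) ^ t" using fin(1) by (simp add: card_lists_length_eq power_mono)
  qed
  also have "\<dots> < card (?L E)" using lt fin(1) by (simp add: card_lists_length_eq)
  finally have "card (\<Union>B\<in>\<B>. ?L (E - B)) < card (?L E)" .
  moreover have "finite (\<Union>B\<in>\<B>. ?L (E - B))"
    using fin by (intro finite_UN_I finite_lists_length_eq finite_Diff)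
  ultimately have "\<not> ?L E \<subseteq> (\<Union>B\<in>\<B>. ?L (E - B))" using card_mono leD by blast
  then obtain xs where xs: "set xs \<subseteq> E" "length xs = t" "\<And>B. B \<in> \<B> \<Longrightarrow> \<not> set xs \<subseteq> E - B" by blast
  show ?thesis using that[of "set xs"] xs card_length[of xs] by blast
qed

text \<open>At most \<open>4 ^ card S\<close> boxes have to be hit, and each contains at least
  \<open>M\<close> of the at most \<open>card S ^ 2\<close> pairs. By the choice of
  \<open>t\<close>, a sample misses a given box with probability at most
  \<open>exp (- 2 * card S)\<close>, which is less than \<open>1 / 4 ^ card S\<close> because
  \<open>ln 4 < 2\<close>.\<close>

lemma expander_hitting_pairs:
  fixes S :: "'a set"
  assumes exp: "\<And>U W. U \<subseteq> S \<Longrightarrow> W \<subseteq> S \<Longrightarrow> U \<inter> W = {} \<Longrightarrow> card U = A \<Longrightarrow> card W = A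
      \<Longrightarrow> \<exists>i\<in>U. \<exists>j\<in>W. (i, j) \<in> E"
    and S: "finite S" "S \<noteq> {}" "E \<subseteq> S \<times> S"
    and b: "b * A \<le> q" and M: "M = b * (q - A)" "0 < M"
    and t: "2 * card S ^ 3 \<le> M * t"
  obtains Y where "Y \<subseteq> E" "card Y \<le> t"
    "\<And>U W. U \<subseteq> S \<Longrightarrow> W \<subseteq> S \<Longrightarrow> U \<inter> W = {} \<Longrightarrow> q \<le> card U \<Longrightarrow> q \<le> card W
      \<Longrightarrow> \<exists>i\<in>U. \<exists>j\<in>W. (i, j) \<in> Y"
proof -
  note conclude = that
  define \<P> where "\<P> = {(U, W). U \<subseteq> S \<and> W \<subseteq> S \<and> U \<inter> W = {} \<and> q \<le> card U \<and> q \<le> card W}"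
  define \<B> where "\<B> = (\<lambda>(U, W). E \<inter> U \<times> W) ` \<P>"
  have finE: "finite E" using S finite_subset by blast
  have sub: "\<P> \<subseteq> Pow S \<times> Pow S" unfolding \<P>_def by auto
  then have finP: "finite \<P>" using S(1) finite_subset by blast
  have B: "B \<subseteq> E \<and> M \<le> card B" if BB: "B \<in> \<B>" for B
  proof -
    obtain U W where UW: "U \<subseteq> S" "W \<subseteq> S" "U \<inter> W = {}" "q \<le> card U" "q \<le> card W" "B = E \<inter> U \<times> W"
      using BB unfolding \<B>_def \<P>_def by blast
    have "b * (q - A) \<le> card (E \<inter> U \<times> W)"
      by (rule expander_edges_lower_bound[where S = S, OF exp]) (use S UW b in auto)
    then show ?thesis unfolding UW(6) M(1) by simp
  qed
  have hit: thesis if Y: "Y \<subseteq> E" "card Y \<le> t" "\<And>B. B \<in> \<B> \<Longrightarrow> Y \<inter> B \<noteq> {}" for Y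
  proof (rule conclude)
    fix U W assume "U \<subseteq> S" "W \<subseteq> S" "U \<inter> W = {}" "q \<le> card U" "q \<le> card W"
    then have "E \<inter> U \<times> W \<in> \<B>" unfolding \<B>_def \<P>_def by auto
    then show "\<exists>i\<in>U. \<exists>j\<in>W. (i, j) \<in> Y" using Y(3) by blast
  qed (use Y in auto)
  show thesis
  proof (cases "\<B> = {}")
    \<comment> \<open>Without any box to hit the empty set will do. Otherwise a box witnesses
      \<open>M \<le> card E\<close>, on which the estimates below rest.\<close>
    case True
    then show thesis using hit[of "{}"] by simp
  next
    case False
    then have ME: "M \<le> card E" using B finE card_mono by (metis all_not_in_conv order_trans)
    let ?e = "real (card E)" and ?s = "card S"
    have e0: "0 < ?e" using ME M(2) by simp
    have "card \<B> \<le> card (Pow S \<times> Pow S)"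
      using card_image_le[OF finP] card_mono[OF _ sub] S(1) unfolding \<B>_def
      by (metis (no_types, lifting) finite_Pow_iff finite_SigmaI order_trans)
    then have card\<B>: "card \<B> \<le> 4 ^ ?s"
      using S(1) by (simp add: card_cartesian_product card_Pow flip: power_mult_distrib)
    have eS: "?e \<le> real ?s ^ 2"
      using card_mono[OF _ S(3)] S(1) by (simp add: card_cartesian_product power2_eq_square flip: of_nat_mult)
    have s0: "0 < ?s" using S by (simp add: card_gt_0_iff)
    have "?e * (2 * ?s) \<le> real ?s ^ 2 * (2 * ?s)" using eS by (intro mult_right_mono) auto
    also have "\<dots> = real (2 * ?s ^ 3)" by (simp add: power2_eq_square power3_eq_cube)
    also have "\<dots> \<le> real (M * t)" using t by (simp only: of_nat_le_iff)
    finally have Mt: "2 * ?s \<le> M * t / ?e" using e0 by (simp add: field_simps)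
    have "real (4 ^ ?s) = exp (?s * ln 4)" by (simp add: exp_of_nat_mult)
    also have "\<dots> < exp (2 * ?s)"
    proof -
      have "ln (4 :: real) = 2 * ln 2" using ln_realpow[of 2 2] by simp
      then have "ln (4 :: real) < 2" using ln_2_less_1 by simp
      then show ?thesis using s0 by simp
    qed
    also have "\<dots> \<le> exp (M * t / ?e)" using Mt by simp
    finally have lt: "real (4 ^ ?s) < exp (M * t / ?e)" .
    have "real (card E - M) ^ t = ?e ^ t * (1 - M / ?e) ^ t"
      using ME e0 by (simp add: of_nat_diff field_simps flip: power_mult_distrib)
    also have "\<dots> \<le> ?e ^ t * exp (- M / ?e) ^ t"
      using ME e0 exp_ge_add_one_self[of "- M / ?e"] by (intro mult_left_mono power_mono) (auto simp: field_simps)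
    also have "\<dots> = ?e ^ t / exp (M * t / ?e)"
      by (simp add: exp_minus field_simps flip: exp_of_nat_mult)
    finally have le: "real (card E - M) ^ t \<le> ?e ^ t / exp (M * t / ?e)" .
    have "real (card \<B> * (card E - M) ^ t) \<le> real (4 ^ ?s) * real (card E - M) ^ t"
      using card\<B> unfolding of_nat_mult of_nat_power[symmetric]
      by (intro mult_right_mono) (simp_all only: of_nat_le_iff of_nat_0_le_iff)
    also have "\<dots> \<le> real (4 ^ ?s) * (?e ^ t / exp (M * t / ?e))" using le by (intro mult_left_mono) auto
    also have "\<dots> < exp (M * t / ?e) * (?e ^ t / exp (M * t / ?e))"
      using lt e0 by (intro mult_strict_right_mono) auto
    also have "\<dots> = real (card E ^ t)" by simp
    finally have few: "card \<B> * (card E - M) ^ t < card E ^ t" by (simp only: of_nat_less_iff)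
    have "finite \<B>" using finP unfolding \<B>_def by simp
    then show thesis by (rule hitting_set_exists[OF finE _ B few]) (assumption, rule hit)
  qed
qed

section \<open>Random functions and their zero sets\<close>

lemma card_functions_two_zeros:
  fixes K :: nat
  assumes "finite S" "i \<in> S" "j \<in> S" "i \<noteq> j"
  shows "card {f \<in> S \<rightarrow>\<^sub>E {..<K}. f i = 0 \<and> f j = 0} * K ^ 2 \<le> K ^ card S"
proof -
  let ?X = "{f \<in> S \<rightarrow>\<^sub>E {..<K}. f i = 0 \<and> f j = 0}"
  have ij: "card {i, j} = 2" "card {i, j} \<le> card S" using assms card_mono[of S "{i, j}"] by simp_all
  have "card ?X \<le> card (S - {i, j} \<rightarrow>\<^sub>E {..<K})"
  proof (rule card_inj_on_le[where f = "\<lambda>f. restrict f (S - {i, j})"])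
    show "inj_on (\<lambda>f. restrict f (S - {i, j})) ?X"
    proof (rule inj_onI)
      fix f g assume fg: "f \<in> ?X" "g \<in> ?X" "restrict f (S - {i, j}) = restrict g (S - {i, j})"
      have "f x = g x" if "x \<in> S" for x
        using fg(1,2) fun_cong[OF fg(3), of x] that by (cases "x = i \<or> x = j") auto
      then show "f = g" using fg by (intro PiE_ext[of f S _ g]) auto
    qed
    show "(\<lambda>f. restrict f (S - {i, j})) ` ?X \<subseteq> (S - {i, j} \<rightarrow>\<^sub>E {..<K})"
      by (intro image_subsetI restrict_PiE_iff[THEN iffD2]) auto
  qed (use assms in \<open>auto intro: finite_PiE\<close>)
  also have "\<dots> = K ^ (card S - 2)" using assms by (simp add: card_PiE card_Diff_subset numeral_2_eq_2)
  finally have "card ?X * K ^ 2 \<le> K ^ (card S - 2) * K ^ 2" by (rule mult_right_mono) simp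
  also have "\<dots> = K ^ card S" using ij by (metis le_add_diff_inverse2 power_add)
  finally show ?thesis .
qed

text \<open>Both ends of a given pair are zeros with probability at most \<open>1 / K ^ 2\<close>.
  Summed over \<open>Y\<close> this is at most one half.\<close>

lemma many_independent_zero_sets:
  fixes K :: nat
  assumes S: "finite S" and Y: "Y \<subseteq> S \<times> S" "\<And>i. (i, i) \<notin> Y" "2 * card Y \<le> K ^ 2" and K: "0 < K"
  shows "K ^ card S \<le> 2 * card {f \<in> S \<rightarrow>\<^sub>E {..<K}. \<forall>(i, j)\<in>Y. f i \<noteq> 0 \<or> f j \<noteq> 0}" (is "_ \<le> 2 * card ?G")
proof -
  let ?F = "S \<rightarrow>\<^sub>E {..<K}"
  let ?X = "\<lambda>(i, j). {f \<in> ?F. f i = 0 \<and> f j = 0}"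
  have finY: "finite Y" using S Y(1) finite_subset by blast
  have finF: "finite ?F" using S by (auto intro: finite_PiE)
  have eq: "?F - ?G = (\<Union>e\<in>Y. ?X e)" by fastforce
  have "card (?F - ?G) * K ^ 2 \<le> (\<Sum>e\<in>Y. card (?X e)) * K ^ 2"
    unfolding eq using finY by (intro mult_right_mono card_UN_le) auto
  also have "\<dots> = (\<Sum>e\<in>Y. card (?X e) * K ^ 2)" by (rule sum_distrib_right)
  also have "\<dots> \<le> (\<Sum>e\<in>Y. K ^ card S)"
  proof (intro sum_mono)
    fix e assume "e \<in> Y"
    then obtain i j where e: "e = (i, j)" "i \<in> S" "j \<in> S" "i \<noteq> j" using Y by (cases e) auto
    show "card (?X e) * K ^ 2 \<le> K ^ card S"
      using card_functions_two_zeros[OF S e(2-4), of K] unfolding e(1) by simp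
  qed
  also have "\<dots> = card Y * K ^ card S" by simp
  finally have "2 * (card (?F - ?G) * K ^ 2) \<le> 2 * card Y * K ^ card S" by simp
  also have "\<dots> \<le> K ^ 2 * K ^ card S" using Y(3) by (rule mult_right_mono) simp
  finally have "2 * card (?F - ?G) \<le> K ^ card S" using K by simp
  moreover have "card ?F = K ^ card S" using S by (simp add: card_PiE)
  moreover have "card (?F - ?G) = card ?F - card ?G" using finF by (intro card_Diff_subset) (auto intro: finite_subset)
  ultimately show ?thesis by linarith
qed

text \<open>The values on \<open>R\<close> are prescribed, and each of \<open>q\<close> further
  coordinates has only \<open>K - 1\<close> choices left.\<close>

lemma card_functions_avoiding_zero:
  fixes K :: nat
  assumes S: "finite S" "R \<subseteq> S" "Q \<subseteq> S - R" "q \<le> card Q"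
    and F: "F \<subseteq> S \<rightarrow>\<^sub>E {..<K}" "\<And>f x. f \<in> F \<Longrightarrow> x \<in> R \<Longrightarrow> f x = g x" "\<And>f x. f \<in> F \<Longrightarrow> x \<in> Q \<Longrightarrow> f x \<noteq> 0"
  shows "card F * K ^ q \<le> K ^ card (S - R) * (K - 1) ^ q"
proof -
  obtain Q' where Q': "Q' \<subseteq> Q" "card Q' = q" using S(4) by (metis obtain_subset_with_card_n)
  let ?D = "S - R"
  let ?X = "PiE ?D (\<lambda>x. if x \<in> Q' then {1..<K} else {..<K})"
  have QD: "Q' \<subseteq> ?D" "finite ?D" using Q'(1) S(1,3) by auto
  then have finQ: "finite Q'" by (rule finite_subset)
  have "card F \<le> card ?X"
  proof (rule card_inj_on_le[where f = "\<lambda>f. restrict f ?D"])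
    show "inj_on (\<lambda>f. restrict f ?D) F"
    proof (rule inj_onI)
      fix f h assume fh: "f \<in> F" "h \<in> F" "restrict f ?D = restrict h ?D"
      have "f x = h x" if "x \<in> S" for x
        using fun_cong[OF fh(3), of x] F(2)[OF fh(1)] F(2)[OF fh(2)] that by (cases "x \<in> R") auto
      then show "f = h" using fh F(1) by (intro PiE_ext[of f S _ h]) auto
    qed
    show "(\<lambda>f. restrict f ?D) ` F \<subseteq> ?X"
    proof (clarify, rule restrict_PiE_iff[THEN iffD2], clarify)
      fix f x assume f: "f \<in> F" and x: "x \<in> S" "x \<notin> R"
      have "f x < K" using F(1) f x by auto
      moreover have "x \<in> Q' \<Longrightarrow> f x \<noteq> 0" using F(3) f Q' by blast
      ultimately show "f x \<in> (if x \<in> Q' then {1..<K} else {..<K})" by auto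
    qed
  qed (use QD in \<open>auto intro!: finite_PiE\<close>)
  also have "card ?X = (\<Prod>x\<in>?D. if x \<in> Q' then K - 1 else K)"
    using QD by (simp add: card_PiE if_distrib[of card] cong: if_cong)
  also have "\<dots> = (K - 1) ^ q * K ^ (card ?D - q)"
    using QD finQ Q' by (simp add: prod.If_cases Int_absorb1 card_Diff_subset Diff_eq[symmetric])
  finally have "card F * K ^ q \<le> (K - 1) ^ q * (K ^ (card ?D - q) * K ^ q)" by (simp add: mult.assoc[symmetric])
  also have "K ^ (card ?D - q) * K ^ q = K ^ card ?D"
    using card_mono[OF QD(2,1)] Q' by (simp flip: power_add)
  finally show ?thesis by (simp add: mult.commute)
qed

text \<open>The fibres of \<open>\<tau>\<close> are split further by the values on the complement of
  \<open>U t \<union> W t\<close>. In such a class \<open>rect\<close> forbids pairs of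
  \<open>Y\<close> between the points of \<open>U t\<close> and those of \<open>W t\<close> that
  vanish for some member. By \<open>hit\<close> one of these two sets has fewer than
  \<open>q\<close> elements, so \<open>q\<close> points never vanish and the class has relative size
  at most \<open>(1 - 1 / K) ^ q\<close>. All classes together contain at least half of all
  functions, which forces many traces.\<close>

lemma rectangle_cover_bound:
  fixes K :: nat and \<tau> :: "('a \<Rightarrow> nat) \<Rightarrow> 'c"
  assumes S: "finite S" and K: "0 < K" and F: "F \<subseteq> S \<rightarrow>\<^sub>E {..<K}" "K ^ card S \<le> 2 * card F"
    and T: "finite T" "\<tau> ` F \<subseteq> T"
    and UW: "\<And>t. t \<in> \<tau> ` F \<Longrightarrow> U t \<subseteq> S \<and> W t \<subseteq> S \<and> U t \<inter> W t = {} \<and> 2 * q \<le> card (U t) \<and> 2 * q \<le> card (W t)"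
    and rect: "\<And>f g i j. f \<in> F \<Longrightarrow> g \<in> F \<Longrightarrow> \<tau> f = \<tau> g
      \<Longrightarrow> (\<And>x. x \<in> S - (U (\<tau> f) \<union> W (\<tau> f)) \<Longrightarrow> f x = g x)
      \<Longrightarrow> i \<in> U (\<tau> f) \<Longrightarrow> j \<in> W (\<tau> f) \<Longrightarrow> f i = 0 \<Longrightarrow> g j = 0 \<Longrightarrow> (i, j) \<notin> Y"
    and hit: "\<And>U W. U \<subseteq> S \<Longrightarrow> W \<subseteq> S \<Longrightarrow> U \<inter> W = {} \<Longrightarrow> q \<le> card U \<Longrightarrow> q \<le> card W
      \<Longrightarrow> \<exists>i\<in>U. \<exists>j\<in>W. (i, j) \<in> Y"
  shows "K ^ q \<le> 2 * card T * (K - 1) ^ q"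
proof -
  have finF: "finite F" using F(1) S by (meson finite_PiE finite_lessThan finite_subset)
  have fib: "card {f \<in> F. \<tau> f = t} * K ^ q \<le> K ^ card S * (K - 1) ^ q" if t: "t \<in> \<tau> ` F" for t
  proof -
    note u = UW[OF t]
    define R where "R = S - (U t \<union> W t)"
    have R: "R \<subseteq> S" "S - R = U t \<union> W t" using u unfolding R_def by auto
    let ?P = "R \<rightarrow>\<^sub>E {..<K}"
    let ?Fg = "\<lambda>g. {f \<in> F. \<tau> f = t \<and> restrict f R = g}"
    have finR: "finite R" using R S finite_subset by blast
    have each: "card (?Fg g) * K ^ q \<le> K ^ card (S - R) * (K - 1) ^ q" for g
    proof -
      define U0 where "U0 = {i \<in> U t. \<exists>f\<in>?Fg g. f i = 0}"
      define W0 where "W0 = {i \<in> W t. \<exists>f\<in>?Fg g. f i = 0}"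
      have agree: "f x = g x" if "f \<in> ?Fg g" "x \<in> R" for f x using that by auto
      have "\<not> (q \<le> card U0 \<and> q \<le> card W0)"
      proof
        assume "q \<le> card U0 \<and> q \<le> card W0"
        then have "\<exists>i\<in>U0. \<exists>j\<in>W0. (i, j) \<in> Y" using u by (intro hit) (auto simp: U0_def W0_def)
        then obtain i j where ij: "i \<in> U0" "j \<in> W0" "(i, j) \<in> Y" by auto
        then obtain f h where fh: "f \<in> ?Fg g" "h \<in> ?Fg g" "f i = 0" "h j = 0" unfolding U0_def W0_def by blast
        have "f x = h x" if "x \<in> S - (U t \<union> W t)" for x
          using agree[OF fh(1)] agree[OF fh(2)] that unfolding R_def by simp
        then have "(i, j) \<notin> Y" using fh ij by (intro rect[of f h i j]) (auto simp: U0_def W0_def)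
        then show False using ij by simp
      qed
      moreover have "finite (U t)" "finite (W t)" using u S finite_subset by blast+
      then have "card (U t - U0) = card (U t) - card U0" "card (W t - W0) = card (W t) - card W0"
        by (auto simp: U0_def W0_def intro!: card_Diff_subset)
      \<comment> \<open>This is where \<open>2 * q\<close> elements are needed: fewer than
        \<open>q\<close> are removed and at least \<open>q\<close> remain.\<close>
      ultimately have "q \<le> card (U t - U0) \<or> q \<le> card (W t - W0)" using u by linarith
      then obtain Q where Q: "Q = U t - U0 \<or> Q = W t - W0" "q \<le> card Q" by blast
      show ?thesis
      proof (rule card_functions_avoiding_zero[OF S R(1), of Q _ _ _ g])
        show "Q \<subseteq> S - R" using Q R(2) by auto
        show "q \<le> card Q" by (rule Q(2))
        show "?Fg g \<subseteq> S \<rightarrow>\<^sub>E {..<K}" using F(1) by blast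
        show "f x = g x" if "f \<in> ?Fg g" "x \<in> R" for f x using that by (rule agree)
        show "f x \<noteq> 0" if f: "f \<in> ?Fg g" and x: "x \<in> Q" for f x
        proof
          assume "f x = 0"
          then have "\<exists>f\<in>?Fg g. f x = 0" using f by (rule bexI)
          then have "x \<in> U t \<Longrightarrow> x \<in> U0" "x \<in> W t \<Longrightarrow> x \<in> W0" unfolding U0_def W0_def by simp_all
          then show False using Q(1) x by blast
        qed
      qed
    qed
    have "{f \<in> F. \<tau> f = t} \<subseteq> (\<Union>g\<in>?P. ?Fg g)"
    proof
      fix f assume f: "f \<in> {f \<in> F. \<tau> f = t}"
      then have "f \<in> S \<rightarrow>\<^sub>E {..<K}" using F(1) by auto
      then have "restrict f R \<in> ?P" using R(1) by (intro restrict_PiE_iff[THEN iffD2]) auto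
      then show "f \<in> (\<Union>g\<in>?P. ?Fg g)" using f by blast
    qed
    then have "card {f \<in> F. \<tau> f = t} \<le> card (\<Union>g\<in>?P. ?Fg g)"
      using finF finR by (intro card_mono) (auto intro: finite_PiE)
    also have "\<dots> \<le> (\<Sum>g\<in>?P. card (?Fg g))" using finR by (intro card_UN_le finite_PiE) auto
    finally have "card {f \<in> F. \<tau> f = t} * K ^ q \<le> (\<Sum>g\<in>?P. card (?Fg g)) * K ^ q" by (rule mult_right_mono) simp
    also have "\<dots> = (\<Sum>g\<in>?P. card (?Fg g) * K ^ q)" by (rule sum_distrib_right)
    also have "\<dots> \<le> (\<Sum>g\<in>?P. K ^ card (S - R) * (K - 1) ^ q)" by (intro sum_mono each)
    also have "\<dots> = K ^ card R * K ^ card (S - R) * (K - 1) ^ q" using finR by (simp add: card_PiE)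
    also have "K ^ card R * K ^ card (S - R) = K ^ card S"
      using R(1) S finR by (simp add: card_Diff_subset card_mono flip: power_add)
    finally show ?thesis .
  qed
  have "K ^ card S * K ^ q \<le> 2 * card F * K ^ q" using F(2) by (rule mult_right_mono) simp
  also have "card F = (\<Sum>t\<in>\<tau> ` F. card {f \<in> F. \<tau> f = t})"
    using sum.image_gen[OF finF, of "\<lambda>_. 1 :: nat" \<tau>] by simp
  also have "2 * (\<Sum>t\<in>\<tau> ` F. card {f \<in> F. \<tau> f = t}) * K ^ q = 2 * (\<Sum>t\<in>\<tau> ` F. card {f \<in> F. \<tau> f = t} * K ^ q)"
    by (simp add: sum_distrib_right)
  also have "\<dots> \<le> 2 * (\<Sum>t\<in>\<tau> ` F. K ^ card S * (K - 1) ^ q)" using fib by (intro mult_left_mono sum_mono) auto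
  also have "\<dots> = 2 * card (\<tau> ` F) * (K ^ card S * (K - 1) ^ q)" by simp
  also have "\<dots> \<le> 2 * card T * (K ^ card S * (K - 1) ^ q)"
    using card_mono[OF T] by (intro mult_right_mono mult_left_mono) auto
  also have "\<dots> = K ^ card S * (2 * card T * (K - 1) ^ q)" by (simp add: mult_ac)
  finally show ?thesis using K by simp
qed

section \<open>Segmentation of paths\<close>

lemma dpath_append:
  "dpath src tgt (es @ fs) u w \<longleftrightarrow> (\<exists>v. dpath src tgt es u v \<and> dpath src tgt fs v w)"
  by (induction es arbitrary: u) auto

lemma dpath_concat:
  assumes "\<And>j. j < k \<Longrightarrow> dpath src tgt (seg j) (v j) (v (Suc j))"
  shows "dpath src tgt (concat (map seg [0..<k])) (v 0) (v k)"
  using assms by (induction k) (auto simp: dpath_append)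

lemma dpath_concat_split:
  assumes "dpath src tgt (concat (map seg [0..<k])) s t"
  obtains v where "v 0 = s" "v k = t" "\<And>j. j < k \<Longrightarrow> dpath src tgt (seg j) (v j) (v (Suc j))"
  using assms
proof (induction k arbitrary: t thesis)
  case 0
  show ?case using 0(2) by (intro 0(1)[of "\<lambda>_. s"]) auto
next
  case (Suc k)
  obtain u where u: "dpath src tgt (concat (map seg [0..<k])) s u" "dpath src tgt (seg k) u t"
    using Suc.prems(2) by (auto simp: dpath_append)
  obtain v where v: "v 0 = s" "v k = u" "\<And>j. j < k \<Longrightarrow> dpath src tgt (seg j) (v j) (v (Suc j))"
    using Suc.IH[OF _ u(1)] by blast
  have "dpath src tgt (seg j) ((v(Suc k := t)) j) ((v(Suc k := t)) (Suc j))" if "j < Suc k" for j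
    using v u that by (cases "j = k") auto
  then show ?case using v by (intro Suc.prems(1)[of "v(Suc k := t)"]) auto
qed

lemma dpath_end_in:
  assumes "dpath src tgt es u v" "set es \<subseteq> Ed" "\<And>e. e \<in> Ed \<Longrightarrow> tgt e \<in> N" "u \<in> N"
  shows "v \<in> N"
  using assms by (induction es arbitrary: u) auto

lemma length_filter_concat:
  "length (filter P (concat (map seg [0..<k]))) = (\<Sum>j<k. length (filter P (seg j)))"
  by (induction k) auto

text \<open>The prefix is taken as long as the budget \<open>a\<close> permits. Truncated
  subtraction covers the case of fewer than \<open>a\<close> matches, where nothing that matches
  remains.\<close>

lemma split_filter_count:
  "\<exists>ys zs. xs = ys @ zs \<and> length (filter P ys) \<le> a \<and> length (filter P zs) \<le> length (filter P xs) - a"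
proof (induction xs arbitrary: a)
  case (Cons x xs)
  show ?case
  proof (cases "P x \<and> a = 0")
    case True
    then show ?thesis by (intro exI[of _ "[]"] exI[of _ "x # xs"]) auto
  next
    case False
    obtain ys zs where "xs = ys @ zs" "length (filter P ys) \<le> (if P x then a - 1 else a)"
      "length (filter P zs) \<le> length (filter P xs) - (if P x then a - 1 else a)"
      using Cons.IH by blast
    then show ?thesis using False
      by (intro exI[of _ "x # ys"] exI[of _ zs]) (auto split: if_splits)
  qed
qed simp

lemma segmentation:
  assumes "length (filter P xs) \<le> k * c" "0 < k"
  obtains seg where "concat (map seg [0..<k]) = xs" "\<And>j. j < k \<Longrightarrow> length (filter P (seg j)) \<le> c"
  using assms
proof (induction k arbitrary: xs thesis)
  case (Suc k)
  show ?case
  proof (cases "k = 0")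
    case True
    then show ?thesis using Suc.prems(2) by (intro Suc.prems(1)[of "\<lambda>_. xs"]) auto
  next
    case False
    obtain ys zs where yz: "xs = ys @ zs" "length (filter P ys) \<le> k * c"
      "length (filter P zs) \<le> length (filter P xs) - k * c"
      using split_filter_count by blast
    obtain seg where seg: "concat (map seg [0..<k]) = ys" "\<And>j. j < k \<Longrightarrow> length (filter P (seg j)) \<le> c"
      using Suc.IH[OF _ yz(2)] False by blast
    have "map (seg(k := zs)) [0..<k] = map seg [0..<k]" by auto
    then have eq: "concat (map (seg(k := zs)) [0..<Suc k]) = xs" using seg(1) yz(1) by simp
    have "length (filter P zs) \<le> c" using yz(3) Suc.prems(2) by simp
    then show ?thesis using seg(2) by (intro Suc.prems(1)[OF eq]) (auto simp: less_Suc_eq)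
  qed
qed simp

lemma length_filter_le_sum:
  assumes "finite S" "\<And>e. P e \<Longrightarrow> \<exists>i\<in>S. Q i e"
  shows "length (filter P es) \<le> (\<Sum>i\<in>S. length (filter (Q i) es))"
proof (induction es)
  case (Cons e es)
  have eq: "(\<Sum>i\<in>S. length (filter (Q i) (e # es)))
      = (\<Sum>i\<in>S. if Q i e then 1 else 0) + (\<Sum>i\<in>S. length (filter (Q i) es))"
    by (simp add: sum.distrib[symmetric] if_distrib cong: if_cong) (intro sum.cong, auto)
  show ?case
  proof (cases "P e")
    case True
    then obtain i where i: "i \<in> S" "Q i e" using assms(2) by blast
    then have "1 \<le> (\<Sum>i\<in>S. if Q i e then 1 else 0 :: nat)"
      using member_le_sum[of i S "\<lambda>i. if Q i e then 1 else 0 :: nat"] assms(1) by simp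
    then show ?thesis using Cons True unfolding eq by simp
  next
    case False
    then show ?thesis using Cons unfolding eq by simp
  qed
qed simp

section \<open>Separation of variables by a random set of segments\<close>

text \<open>The condition decides membership for at most \<open>2 * d\<close> indices and leaves the
  others free, so a random set satisfies it with probability at least
  \<open>1 / 4 ^ d\<close>.\<close>

lemma card_sets_between:
  fixes B B' :: "nat set"
  assumes "B \<subseteq> {..<k}" "B' \<subseteq> {..<k}" "B \<inter> B' = {}" "card B \<le> d" "card B' \<le> d"
  shows "2 ^ k \<le> 4 ^ d * card {O'. O' \<subseteq> {..<k} \<and> B \<subseteq> O' \<and> B' \<inter> O' = {}}"
proof -
  let ?D = "{..<k} - (B \<union> B')"
  have fin: "finite B" "finite B'" using assms(1,2) finite_subset by blast+
  have "card (B \<union> B') = card B + card B'" using fin assms(3) by (rule card_Un_disjoint)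
  then have D: "card ?D = k - (card B + card B')" "card B + card B' \<le> k"
    using assms(1,2) fin card_mono[of "{..<k}" "B \<union> B'"] by (auto simp: card_Diff_subset)
  have sub: "(\<lambda>X. B \<union> X) ` Pow ?D \<subseteq> {O'. O' \<subseteq> {..<k} \<and> B \<subseteq> O' \<and> B' \<inter> O' = {}}" using assms by auto
  have inj: "inj_on (\<lambda>X. B \<union> X) (Pow ?D)" by (rule inj_onI) blast
  have "finite {O'. O' \<subseteq> {..<k} \<and> B \<subseteq> O' \<and> B' \<inter> O' = {}}"
    by (rule finite_subset[of _ "Pow {..<k}"]) auto
  then have "card (Pow ?D) \<le> card {O'. O' \<subseteq> {..<k} \<and> B \<subseteq> O' \<and> B' \<inter> O' = {}}"
    by (rule card_inj_on_le[OF inj sub])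
  then have le: "2 ^ card ?D \<le> card {O'. O' \<subseteq> {..<k} \<and> B \<subseteq> O' \<and> B' \<inter> O' = {}}" by (simp add: card_Pow)
  have "(2 :: nat) ^ k = 2 ^ (card B + card B') * 2 ^ card ?D" using D by (simp flip: power_add)
  also have "\<dots> \<le> 2 ^ (2 * d) * 2 ^ card ?D" using assms(4,5) by (intro mult_right_mono power_increasing) auto
  also have "\<dots> = 4 ^ d * 2 ^ card ?D" by (simp add: power_mult)
  also have "\<dots> \<le> 4 ^ d * card {O'. O' \<subseteq> {..<k} \<and> B \<subseteq> O' \<and> B' \<inter> O' = {}}"
    using le by (rule mult_left_mono) simp
  finally show ?thesis .
qed

text \<open>A pair of elements with disjoint index sets is separated by a uniformly random set of indices with
  probability at least \<open>1 / 4 ^ d\<close>, so averaging the product of the two cardinalities suffices.\<close>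
lemma separating_index_set:
  fixes B :: "'a \<Rightarrow> nat set"
  assumes S: "finite S" "S \<noteq> {}"
    and B: "\<And>i. i \<in> S \<Longrightarrow> B i \<subseteq> {..<k} \<and> card (B i) \<le> d"
    and pairs: "\<And>i. i \<in> S \<Longrightarrow> 2 * card {j \<in> S. B i \<inter> B j \<noteq> {}} \<le> card S"
  obtains O' where "O' \<subseteq> {..<k}" "card S \<le> 2 * 4 ^ d * card {i \<in> S. B i \<subseteq> O'}"
    "card S \<le> 2 * 4 ^ d * card {i \<in> S. B i \<inter> O' = {}}"
proof -
  let ?P = "Pow {..<k}"
  let ?X = "\<lambda>O'. {i \<in> S. B i \<subseteq> O'}" and ?X' = "\<lambda>O'. {i \<in> S. B i \<inter> O' = {}}"
  let ?s = "card S"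
  have finP: "finite ?P" by simp
  have prod: "card (?X O') * card (?X' O') = (\<Sum>p\<in>S \<times> S. of_bool (B (fst p) \<subseteq> O' \<and> B (snd p) \<inter> O' = {}))" for O'
  proof -
    have "(S \<times> S) \<inter> {p. B (fst p) \<subseteq> O' \<and> B (snd p) \<inter> O' = {}} = ?X O' \<times> ?X' O'" by auto
    then show ?thesis using S(1) by (simp add: sum_of_bool_eq card_cartesian_product)
  qed
  define D where "D = (SIGMA i:S. {j \<in> S. B i \<inter> B j = {}})"
  \<comment> \<open>By \<open>pairs\<close>, at least half of all ordered pairs have disjoint index
    sets.\<close>
  have "?s * ?s \<le> 2 * card D"
  proof -
    have "?s \<le> 2 * card {j \<in> S. B i \<inter> B j = {}}" if i: "i \<in> S" for i
    proof -
      have "{j \<in> S. B i \<inter> B j = {}} = S - {j \<in> S. B i \<inter> B j \<noteq> {}}" by auto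
      then have "card {j \<in> S. B i \<inter> B j = {}} = ?s - card {j \<in> S. B i \<inter> B j \<noteq> {}}"
        using S(1) by (simp add: card_Diff_subset)
      then show ?thesis using pairs[OF i] by linarith
    qed
    then have "(\<Sum>i\<in>S. ?s) \<le> (\<Sum>i\<in>S. 2 * card {j \<in> S. B i \<inter> B j = {}})" by (intro sum_mono)
    also have "\<dots> = 2 * card D" using S(1) unfolding D_def by (simp add: card_SigmaI sum_distrib_left)
    finally show ?thesis by simp
  qed
  then have "2 ^ k * (?s * ?s) \<le> 2 ^ k * (2 * card D)" by (rule mult_left_mono) simp
  also have "\<dots> = 2 * (\<Sum>p\<in>D. 2 ^ k)" by simp
  also have "\<dots> \<le> 2 * (\<Sum>p\<in>D. 4 ^ d * (\<Sum>O'\<in>?P. of_bool (B (fst p) \<subseteq> O' \<and> B (snd p) \<inter> O' = {})))"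
  proof (intro mult_left_mono sum_mono)
    fix p assume "p \<in> D"
    then have p: "fst p \<in> S" "snd p \<in> S" "B (fst p) \<inter> B (snd p) = {}" unfolding D_def by auto
    have "?P \<inter> {O'. B (fst p) \<subseteq> O' \<and> B (snd p) \<inter> O' = {}}
        = {O'. O' \<subseteq> {..<k} \<and> B (fst p) \<subseteq> O' \<and> B (snd p) \<inter> O' = {}}" by auto
    then show "(2 :: nat) ^ k \<le> 4 ^ d * (\<Sum>O'\<in>?P. of_bool (B (fst p) \<subseteq> O' \<and> B (snd p) \<inter> O' = {}))"
      using card_sets_between[of "B (fst p)" k "B (snd p)" d] B p finP by (simp add: sum_of_bool_eq)
  qed simp
  also have "\<dots> \<le> 2 * (\<Sum>p\<in>S \<times> S. 4 ^ d * (\<Sum>O'\<in>?P. of_bool (B (fst p) \<subseteq> O' \<and> B (snd p) \<inter> O' = {})))"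
    using S(1) by (intro mult_left_mono sum_mono2) (auto simp: D_def)
  also have "\<dots> = 2 * 4 ^ d * (\<Sum>p\<in>S \<times> S. \<Sum>O'\<in>?P. of_bool (B (fst p) \<subseteq> O' \<and> B (snd p) \<inter> O' = {}))"
    by (simp only: sum_distrib_left mult.assoc)
  also have "\<dots> = 2 * 4 ^ d * (\<Sum>O'\<in>?P. card (?X O') * card (?X' O'))"
    unfolding prod by (subst sum.swap) simp
  also have "\<dots> = (\<Sum>O'\<in>?P. 2 * 4 ^ d * (card (?X O') * card (?X' O')))" by (simp only: sum_distrib_left)
  finally have sum: "2 ^ k * (?s * ?s) \<le> (\<Sum>O'\<in>?P. 2 * 4 ^ d * (card (?X O') * card (?X' O')))" .
  have "\<exists>O'\<in>?P. ?s * ?s \<le> 2 * 4 ^ d * (card (?X O') * card (?X' O'))"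
  proof (rule ccontr)
    assume "\<not> ?thesis"
    then have "\<forall>O'\<in>?P. 2 * 4 ^ d * (card (?X O') * card (?X' O')) < ?s * ?s" by (simp only: not_le bex_simps)
    then have "(\<Sum>O'\<in>?P. 2 * 4 ^ d * (card (?X O') * card (?X' O'))) < (\<Sum>O'\<in>?P. ?s * ?s)"
      by (intro sum_strict_mono) (auto simp only: finP)
    also have "\<dots> = 2 ^ k * (?s * ?s)" by (simp add: card_Pow)
    finally show False using sum by simp
  qed
  then obtain O' where O': "O' \<subseteq> {..<k}" "?s * ?s \<le> 2 * 4 ^ d * (card (?X O') * card (?X' O'))" by auto
  have le: "card (?X O') \<le> ?s" "card (?X' O') \<le> ?s" using S(1) by (auto intro: card_mono)
  have s0: "0 < ?s" using S by (simp add: card_gt_0_iff)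
  \<comment> \<open>Neither factor exceeds \<open>?s\<close>, so a lower bound on the product bounds
    each factor separately.\<close>
  have "?s * ?s \<le> 2 * 4 ^ d * (card (?X O') * ?s)"
    by (rule order_trans[OF O'(2)]) (intro mult_left_mono le(2), simp_all)
  moreover have "?s * ?s \<le> 2 * 4 ^ d * (?s * card (?X' O'))"
    by (rule order_trans[OF O'(2)]) (intro mult_left_mono mult_right_mono le(1), simp_all)
  ultimately have "?s * ?s \<le> 2 * 4 ^ d * card (?X O') * ?s" "?s * ?s \<le> 2 * 4 ^ d * card (?X' O') * ?s"
    by (simp_all only: mult_ac)
  then show ?thesis using s0 by (intro that[OF O'(1)]) simp_all
qed

section \<open>Uniform branching programs\<close>

definition reads :: "('e \<Rightarrow> ('v \<times> bool) option) \<Rightarrow> 'v \<Rightarrow> 'e \<Rightarrow> bool" where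
  "reads lab x e \<longleftrightarrow> (\<exists>b. lab e = Some (x, b))"

definition segmented ::
  "'e set \<Rightarrow> ('e \<Rightarrow> 'n) \<Rightarrow> ('e \<Rightarrow> 'n) \<Rightarrow> 'n \<Rightarrow> 'n \<Rightarrow> nat \<Rightarrow> (nat \<Rightarrow> 'n) \<Rightarrow> (nat \<Rightarrow> 'e list) \<Rightarrow> bool" where
  "segmented Ed src tgt s t k v seg \<longleftrightarrow> v 0 = s \<and> v k = t \<and>
     (\<forall>j<k. set (seg j) \<subseteq> Ed \<and> dpath src tgt (seg j) (v j) (v (Suc j)))"

definition reading_segs :: "('e \<Rightarrow> ('v \<times> bool) option) \<Rightarrow> nat \<Rightarrow> (nat \<Rightarrow> 'e list) \<Rightarrow> 'v \<Rightarrow> nat set" where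
  "reading_segs lab k seg x = {j. j < k \<and> (\<exists>e\<in>set (seg j). reads lab x e)}"

lemma segmented_st_path:
  assumes "segmented Ed src tgt s t k v seg"
  shows "st_path Ed src tgt s t (concat (map seg [0..<k]))"
  using assms dpath_concat[of k src tgt seg v] unfolding segmented_def st_path_def by fastforce

lemma segmented_mix:
  assumes "segmented Ed src tgt s t k v seg" "segmented Ed src tgt s t k v seg'"
  shows "segmented Ed src tgt s t k v (\<lambda>j. if j \<in> A then seg j else seg' j)"
  using assms unfolding segmented_def by simp

lemma segmented_nodes:
  assumes seg: "segmented Ed src tgt s t k v seg" and N: "s \<in> N" "\<And>e. e \<in> Ed \<Longrightarrow> tgt e \<in> N"
  shows "j \<le> k \<Longrightarrow> v j \<in> N"
proof (induction j)
  case 0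
  then show ?case using seg N unfolding segmented_def by simp
next
  case (Suc j)
  then have "set (seg j) \<subseteq> Ed" "dpath src tgt (seg j) (v j) (v (Suc j))" using seg unfolding segmented_def by auto
  then show ?case using dpath_end_in[of src tgt "seg j" "v j" "v (Suc j)" Ed N] N(2) Suc by simp
qed

lemma uniform_read_count:
  assumes "uniform_read N Ed src tgt lab s t d" "st_path Ed src tgt s t es" "x \<in> nbp_vars Ed lab"
  shows "length (filter (reads lab x) es) = d"
  using assms unfolding uniform_read_def reads_def by blast

text \<open>Exchange argument: replacing only segment \<open>j\<close> gives another source-sink
  path through the same nodes. Uniformity gives both paths exactly \<open>d\<close> readings of
  \<open>x\<close>, so the old and the new segment read \<open>x\<close> equally often.\<close>

lemma segmented_read_count:
  assumes unif: "uniform_read N Ed src tgt lab s t d" and x: "x \<in> nbp_vars Ed lab"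
    and seg: "segmented Ed src tgt s t k v seg" and seg': "segmented Ed src tgt s t k v seg'" and j: "j < k"
  shows "length (filter (reads lab x) (seg j)) = length (filter (reads lab x) (seg' j))"
proof -
  let ?h = "\<lambda>i. if i \<in> {j} then seg' i else seg i"
  let ?c = "\<lambda>g i. length (filter (reads lab x) (g i))"
  have total: "(\<Sum>i<k. ?c seg i) = (\<Sum>i<k. ?c ?h i)"
    using uniform_read_count[OF unif segmented_st_path[OF seg] x]
      uniform_read_count[OF unif segmented_st_path[OF segmented_mix[OF seg' seg, of "{j}"]] x]
    unfolding length_filter_concat by simp
  have split: "(\<Sum>i<k. ?c g i) = ?c g j + (\<Sum>i\<in>{..<k} - {j}. ?c g i)" for g
    using j by (intro sum.remove) auto
  have "(\<Sum>i\<in>{..<k} - {j}. ?c seg i) = (\<Sum>i\<in>{..<k} - {j}. ?c ?h i)"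
    by (intro sum.cong) auto
  then have "?c seg j = ?c ?h j" using total split[of seg] split[of ?h] by linarith
  then show ?thesis by simp
qed

lemma reading_segs_alt: "reading_segs lab k seg x = {j. j < k \<and> length (filter (reads lab x) (seg j)) \<noteq> 0}"
  unfolding reading_segs_def by (auto simp: filter_empty_conv)

text \<open>Which segments read a variable is thus a property of the boundary nodes alone, so the
  sets \<open>U\<close> and \<open>W\<close> below can be functions of the trace.\<close>

lemma reading_segs_cong:
  assumes "uniform_read N Ed src tgt lab s t d" "x \<in> nbp_vars Ed lab"
    "segmented Ed src tgt s t k v seg" "segmented Ed src tgt s t k v seg'"
  shows "reading_segs lab k seg x = reading_segs lab k seg' x"
  unfolding reading_segs_alt using segmented_read_count[OF assms] by (intro Collect_cong) (simp cong: conj_cong del: length_0_conv)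

lemma reading_segs_card:
  assumes unif: "uniform_read N Ed src tgt lab s t d" and x: "x \<in> nbp_vars Ed lab"
    and seg: "segmented Ed src tgt s t k v seg"
  shows "card (reading_segs lab k seg x) \<le> d" "0 < d \<Longrightarrow> reading_segs lab k seg x \<noteq> {}"
proof -
  let ?c = "\<lambda>j. length (filter (reads lab x) (seg j))"
  have sum: "(\<Sum>j<k. ?c j) = d"
    using uniform_read_count[OF unif segmented_st_path[OF seg] x] unfolding length_filter_concat .
  have "card (reading_segs lab k seg x) = (\<Sum>j\<in>reading_segs lab k seg x. 1)" by simp
  also have "\<dots> \<le> (\<Sum>j\<in>reading_segs lab k seg x. ?c j)"
    by (intro sum_mono) (simp add: reading_segs_alt Suc_le_eq)
  also have "\<dots> \<le> (\<Sum>j<k. ?c j)" by (intro sum_mono2) (auto simp: reading_segs_def)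
  finally show "card (reading_segs lab k seg x) \<le> d" using sum by simp
  show "reading_segs lab k seg x \<noteq> {}" if "0 < d"
  proof
    assume "reading_segs lab k seg x = {}"
    then have "(\<Sum>j<k. ?c j) = 0" unfolding reading_segs_alt by auto
    then show False using sum that by simp
  qed
qed

lemma card_variables_read:
  assumes "inj_on r S" "finite S"
  shows "card {i \<in> S. \<exists>e\<in>set es. reads lab (r i) e} \<le> length (filter (\<lambda>e. \<exists>i\<in>S. reads lab (r i) e) es)"
proof -
  let ?f = "filter (\<lambda>e. \<exists>i\<in>S. reads lab (r i) e) es"
  let ?g = "\<lambda>e. inv_into S r (fst (the (lab e)))"
  have "{i \<in> S. \<exists>e\<in>set es. reads lab (r i) e} \<subseteq> ?g ` set ?f"
  proof
    fix i assume "i \<in> {i \<in> S. \<exists>e\<in>set es. reads lab (r i) e}"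
    then obtain e where i: "i \<in> S" "e \<in> set es" "reads lab (r i) e" by auto
    then have "?g e = i" "e \<in> set ?f" using assms(1) unfolding reads_def by auto
    then show "i \<in> ?g ` set ?f" by blast
  qed
  then have "card {i \<in> S. \<exists>e\<in>set es. reads lab (r i) e} \<le> card (?g ` set ?f)" by (intro card_mono) auto
  also have "\<dots> \<le> card (set ?f)" by (intro card_image_le) simp
  also have "\<dots> \<le> length ?f" by (rule card_length)
  finally show ?thesis .
qed

text \<open>A path whose labels all agree with one assignment cannot carry opposite literals, so the
  requirement that it be computational is automatic.\<close>

lemma nbp_computes_accept:
  assumes "nbp_computes N Ed src tgt lab s t X \<phi>"
  shows "\<phi> \<sigma> \<longleftrightarrow> (\<exists>es. st_path Ed src tgt s t es \<and> (\<forall>e\<in>set es. \<forall>x b. lab e = Some (x, b) \<longrightarrow> \<sigma> x = b))"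
proof -
  let ?sat = "\<lambda>es. \<forall>e\<in>set es. \<forall>x b. lab e = Some (x, b) \<longrightarrow> \<sigma> x = b"
  have sat: "(\<forall>(x, b)\<in>path_lits lab es. \<sigma> x = b) \<longleftrightarrow> ?sat es" for es
    unfolding path_lits_def by auto
  have "computational lab es" if "\<forall>(x, b)\<in>path_lits lab es. \<sigma> x = b" for es
    unfolding computational_def
  proof
    assume "\<exists>x. (x, True) \<in> path_lits lab es \<and> (x, False) \<in> path_lits lab es"
    then obtain x where "(x, True) \<in> path_lits lab es" "(x, False) \<in> path_lits lab es" by blast
    from bspec[OF that this(1)] bspec[OF that this(2)] show False by simp
  qed
  then have "computational lab es \<and> (\<forall>(x, b)\<in>path_lits lab es. \<sigma> x = b) \<longleftrightarrow> ?sat es" for es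
    unfolding sat[symmetric] by blast
  then show ?thesis using assms unfolding nbp_computes_def by simp
qed

text \<open>An element conflicts with another one if some segment reads both of their variables. It
  is read in at most \<open>d\<close> segments, each reading at most \<open>c\<close> variables, so
  it conflicts with at most \<open>d * c \<le> card S / 2\<close> elements, as
  \<open>separating_index_set\<close> requires.\<close>

lemma balanced_segmentation:
  assumes unif: "uniform_read N Ed src tgt lab s t d" and d: "0 < d" "4 * d \<le> card S"
    and S: "finite S" "inj_on r S" "r ` S \<subseteq> nbp_vars Ed lab"
    and es: "st_path Ed src tgt s t es" and k: "k = 4 * d ^ 2"
  obtains v seg A where "segmented Ed src tgt s t k v seg" "concat (map seg [0..<k]) = es" "A \<subseteq> {..<k}"
    "card S \<le> 2 * 4 ^ d * card {i \<in> S. reading_segs lab k seg (r i) \<subseteq> A}"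
    "card S \<le> 2 * 4 ^ d * card {i \<in> S. reading_segs lab k seg (r i) \<inter> A = {}}"
proof -
  let ?P = "\<lambda>e. \<exists>i\<in>S. reads lab (r i) e"
  \<comment> \<open>Rounding down keeps \<open>d * c\<close> below half of \<open>card S\<close>;
    \<open>4 * d \<le> card S\<close> limits the rounding loss, so that \<open>4 * d ^ 2\<close>
    segments with \<open>c\<close> readings each still hold all \<open>d * card S\<close>
    readings.\<close>
  define c where "c = card S div (2 * d)"
  have c1: "2 * d * c \<le> card S" unfolding c_def by simp
  have "card S < 2 * d * c + 2 * d" unfolding c_def using d(1)
    by (metis add.commute dividend_less_times_div mult_pos_pos zero_less_numeral)
  then have c2: "card S \<le> 4 * d * c" using d(2) by simp
  have "length (filter ?P es) \<le> (\<Sum>i\<in>S. length (filter (reads lab (r i)) es))"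
    using S(1) by (intro length_filter_le_sum) auto
  also have "\<dots> = (\<Sum>i\<in>S. d)" using uniform_read_count[OF unif es] S(3) by (intro sum.cong) auto
  also have "\<dots> = d * card S" by simp
  also have "\<dots> \<le> d * (4 * d * c)" using c2 by (rule mult_left_mono) simp
  also have "\<dots> = k * c" unfolding k by (simp add: power2_eq_square)
  finally have "length (filter ?P es) \<le> k * c" .
  moreover have "0 < k" using d k by simp
  ultimately obtain seg where seg: "concat (map seg [0..<k]) = es" "\<And>j. j < k \<Longrightarrow> length (filter ?P (seg j)) \<le> c"
    by (rule segmentation) (rule that)
  have "dpath src tgt (concat (map seg [0..<k])) s t" using es seg(1) unfolding st_path_def by simp
  then obtain v where v: "v 0 = s" "v k = t" "\<And>j. j < k \<Longrightarrow> dpath src tgt (seg j) (v j) (v (Suc j))"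
    by (rule dpath_concat_split) (rule that)
  have "set (seg j) \<subseteq> Ed" if "j < k" for j
  proof -
    have "set (seg j) \<subseteq> set es" using that by (auto simp flip: seg(1))
    then show ?thesis using es unfolding st_path_def by blast
  qed
  then have sg: "segmented Ed src tgt s t k v seg" using v unfolding segmented_def by simp
  let ?B = "\<lambda>i. reading_segs lab k seg (r i)"
  have B: "?B i \<subseteq> {..<k} \<and> card (?B i) \<le> d" if "i \<in> S" for i
    using reading_segs_card(1)[OF unif _ sg] S(3) that by (auto simp: reading_segs_def)
  have pairs: "2 * card {j \<in> S. ?B i \<inter> ?B j \<noteq> {}} \<le> card S" if i: "i \<in> S" for i
  proof -
    have finB: "finite (?B i)" unfolding reading_segs_def by simp
    have "{j \<in> S. ?B i \<inter> ?B j \<noteq> {}} \<subseteq> (\<Union>a\<in>?B i. {j \<in> S. \<exists>e\<in>set (seg a). reads lab (r j) e})"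
      unfolding reading_segs_def by auto
    then have "card {j \<in> S. ?B i \<inter> ?B j \<noteq> {}} \<le> card (\<Union>a\<in>?B i. {j \<in> S. \<exists>e\<in>set (seg a). reads lab (r j) e})"
      using finB S(1) by (intro card_mono) auto
    also have "\<dots> \<le> (\<Sum>a\<in>?B i. card {j \<in> S. \<exists>e\<in>set (seg a). reads lab (r j) e})"
      using finB by (rule card_UN_le)
    also have "\<dots> \<le> (\<Sum>a\<in>?B i. c)"
    proof (intro sum_mono)
      fix a assume "a \<in> ?B i"
      then have "a < k" unfolding reading_segs_def by simp
      then show "card {j \<in> S. \<exists>e\<in>set (seg a). reads lab (r j) e} \<le> c"
        using card_variables_read[OF S(2,1), of "seg a" lab] seg(2) by (meson order_trans)
    qed
    also have "\<dots> \<le> d * c" using B[OF i] by simp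
    finally show ?thesis using c1 by simp
  qed
  have "S \<noteq> {}" using d by auto
  from separating_index_set[OF S(1) this B pairs] obtain A where
    "A \<subseteq> {..<k}" "card S \<le> 2 * 4 ^ d * card {i \<in> S. ?B i \<subseteq> A}" "card S \<le> 2 * 4 ^ d * card {i \<in> S. ?B i \<inter> A = {}}"
    by blast
  then show ?thesis by (rule that[OF sg seg(1)])
qed

lemma spliced_path_accepts:
  assumes comp: "nbp_computes N Ed src tgt lab s t X \<phi>"
    and seg: "segmented Ed src tgt s t k v seg" "segmented Ed src tgt s t k v seg'"
    and \<sigma>: "\<And>j e x b. j < k \<Longrightarrow> j \<in> A \<Longrightarrow> e \<in> set (seg j) \<Longrightarrow> lab e = Some (x, b) \<Longrightarrow> \<sigma> x = b"
      "\<And>j e x b. j < k \<Longrightarrow> j \<notin> A \<Longrightarrow> e \<in> set (seg' j) \<Longrightarrow> lab e = Some (x, b) \<Longrightarrow> \<sigma> x = b"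
  shows "\<phi> \<sigma>"
proof -
  let ?h = "\<lambda>j. if j \<in> A then seg j else seg' j"
  have "st_path Ed src tgt s t (concat (map ?h [0..<k]))"
    by (rule segmented_st_path[OF segmented_mix[OF seg]])
  moreover have "\<sigma> x = b" if e: "e \<in> set (concat (map ?h [0..<k]))" and x: "lab e = Some (x, b)" for e x b
  proof -
    obtain j where "j < k" "e \<in> set (?h j)" using e by auto
    then show ?thesis using \<sigma>(1)[OF _ _ _ x] \<sigma>(2)[OF _ _ _ x] by (cases "j \<in> A") auto
  qed
  ultimately show ?thesis unfolding nbp_computes_accept[OF comp] by blast
qed

text \<open>The graph enters only through \<open>\<sigma>\<close>, a restriction under which the
  computed function says that a set is independent in \<open>Y\<close>. The traces of accepted paths
  supply the classes for \<open>rectangle_cover_bound\<close>.\<close>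

lemma uniform_nbp_independent_bound:
  fixes S :: "'i set" and r :: "'i \<Rightarrow> 'v" and \<sigma> :: "'i set \<Rightarrow> 'v \<Rightarrow> bool" and K q d :: nat
  assumes unif: "uniform_read N Ed src tgt lab s t d"
    and comp: "nbp_computes N Ed src tgt lab s t X \<phi>"
    and S: "finite S" "inj_on r S" "r ` S \<subseteq> X"
    and \<sigma>_root: "\<And>I i. i \<in> S \<Longrightarrow> \<sigma> I (r i) \<longleftrightarrow> i \<notin> I"
    and \<sigma>_other: "\<And>I J x. x \<notin> r ` S \<Longrightarrow> \<sigma> I x = \<sigma> J x"
    and \<phi>: "\<And>I. \<phi> (\<sigma> I) \<longleftrightarrow> (\<forall>(i, j)\<in>Y. i \<notin> I \<or> j \<notin> I)"
    and Y: "Y \<subseteq> S \<times> S" "\<And>i. (i, i) \<notin> Y" "2 * card Y \<le> K ^ 2"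
    and hit: "\<And>U W. U \<subseteq> S \<Longrightarrow> W \<subseteq> S \<Longrightarrow> U \<inter> W = {} \<Longrightarrow> q \<le> card U \<Longrightarrow> q \<le> card W
      \<Longrightarrow> \<exists>i\<in>U. \<exists>j\<in>W. (i, j) \<in> Y"
    and K: "0 < K" and size: "4 * d \<le> card S" "4 * 4 ^ d * q \<le> card S"
  shows "K ^ q \<le> 2 * (card N ^ (4 * d ^ 2 + 1) * 2 ^ (4 * d ^ 2)) * (K - 1) ^ q"
proof (cases "d = 0")
  case True
  have X: "nbp_vars Ed lab = X" using comp unfolding nbp_computes_def by simp
  have "\<phi> (\<sigma> {})" unfolding \<phi> by auto
  then obtain es where es: "st_path Ed src tgt s t es" "\<And>e x b. e \<in> set es \<Longrightarrow> lab e = Some (x, b) \<Longrightarrow> \<sigma> {} x = b"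
    unfolding nbp_computes_accept[OF comp] by blast
  \<comment> \<open>For \<open>d = 0\<close> no path reads a variable of \<open>X\<close>, so the
    path accepting the empty set also accepts all of \<open>S\<close>. Then \<open>Y\<close> has no
    pairs, contrary to \<open>hit\<close>.\<close>
  have "\<sigma> S x = b" if e: "e \<in> set es" "lab e = Some (x, b)" for e x b
  proof -
    have "filter (reads lab x) es \<noteq> []" using e unfolding reads_def by (auto simp: filter_empty_conv)
    then have "x \<notin> X" using uniform_read_count[OF unif es(1), of x] True X by auto
    then have "\<sigma> S x = \<sigma> {} x" using S(3) by (intro \<sigma>_other) blast
    then show ?thesis using es(2)[OF e] by simp
  qed
  then have "\<phi> (\<sigma> S)" unfolding nbp_computes_accept[OF comp] using es(1) by blast
  then have none: "(i, j) \<notin> Y" if "i \<in> S" "j \<in> S" for i j unfolding \<phi> using that by blast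
  obtain U where U: "U \<subseteq> S" "card U = q" using size(2) True obtain_subset_with_card_n[of q S] by auto
  have "card (S - U) = card S - q" using U S(1) by (simp add: card_Diff_subset finite_subset)
  then have "q \<le> card (S - U)" using size(2) True by simp
  then have "\<exists>i\<in>U. \<exists>j\<in>S - U. (i, j) \<in> Y" using U by (intro hit) auto
  then show ?thesis using none U(1) by blast
next
  case False
  then have d: "0 < d" by simp
  have X: "r ` S \<subseteq> nbp_vars Ed lab" using comp S(3) unfolding nbp_computes_def by simp
  have nbp: "finite N" "s \<in> N" "\<And>e. e \<in> Ed \<Longrightarrow> tgt e \<in> N"
    using unif unfolding uniform_read_def is_nbp_def by auto
  define k where "k = 4 * d ^ 2"
  define F where "F = {f \<in> S \<rightarrow>\<^sub>E {..<K}. \<forall>(i, j)\<in>Y. f i \<noteq> 0 \<or> f j \<noteq> 0}"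
  define Z where "Z f = {i \<in> S. f i = 0}" for f :: "'i \<Rightarrow> nat"
  define G where "G f v seg A \<longleftrightarrow> segmented Ed src tgt s t k v seg \<and> A \<subseteq> {..<k} \<and>
      (\<forall>j<k. \<forall>e\<in>set (seg j). \<forall>x b. lab e = Some (x, b) \<longrightarrow> \<sigma> (Z f) x = b) \<and>
      2 * q \<le> card {i \<in> S. reading_segs lab k seg (r i) \<subseteq> A} \<and>
      2 * q \<le> card {i \<in> S. reading_segs lab k seg (r i) \<inter> A = {}}" for f v seg A
  have "\<exists>v seg A. G f v seg A" if f: "f \<in> F" for f
  proof -
    have "\<phi> (\<sigma> (Z f))" unfolding \<phi> Z_def using f unfolding F_def by auto
    then obtain es where es: "st_path Ed src tgt s t es"
      "\<And>e x b. e \<in> set es \<Longrightarrow> lab e = Some (x, b) \<Longrightarrow> \<sigma> (Z f) x = b"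
      unfolding nbp_computes_accept[OF comp] by blast
    obtain v seg A where *: "segmented Ed src tgt s t k v seg" "concat (map seg [0..<k]) = es" "A \<subseteq> {..<k}"
      "card S \<le> 2 * 4 ^ d * card {i \<in> S. reading_segs lab k seg (r i) \<subseteq> A}"
      "card S \<le> 2 * 4 ^ d * card {i \<in> S. reading_segs lab k seg (r i) \<inter> A = {}}"
      by (rule balanced_segmentation[OF unif d size(1) S(1,2) X es(1) k_def])
    \<comment> \<open>The separation loses a factor \<open>2 * 4 ^ d\<close> and the rectangle
      argument asks for \<open>2 * q\<close> elements, whence the factor \<open>4 * 4 ^ d\<close> in
      \<open>size\<close>.\<close>
    have "2 * q \<le> n" if "card S \<le> 2 * 4 ^ d * n" for n
    proof -
      have "2 * 4 ^ d * (2 * q) = 4 * 4 ^ d * q" by simp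
      then have "2 * 4 ^ d * (2 * q) \<le> 2 * 4 ^ d * n" using that size(2) by linarith
      then show ?thesis by (simp only: mult_le_cancel1) simp
    qed
    moreover have "\<sigma> (Z f) x = b" if "j < k" "e \<in> set (seg j)" "lab e = Some (x, b)" for j e x b
    proof -
      have "e \<in> set es" using that(1,2) by (auto simp flip: *(2))
      then show ?thesis using es(2) that(3) by blast
    qed
    ultimately have "G f v seg A" unfolding G_def using * by simp
    then show ?thesis by blast
  qed
  then obtain v seg A where G: "\<And>f. f \<in> F \<Longrightarrow> G f (v f) (seg f) (A f)" by metis
  define B where "B f i = reading_segs lab k (seg f) (r i)" for f i
  \<comment> \<open>The trace consists of the \<open>k + 1\<close> boundary nodes and the chosen set
    of segments.\<close>
  define \<tau> where "\<tau> f = (map (v f) [0..<Suc k], A f)" for f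
  \<comment> \<open>\<open>U\<close> and \<open>W\<close> must depend on the trace alone, so they
    are read off from a representative; by \<open>B_cong\<close> every other function with the same
    trace gives the same sets.\<close>
  define pick where "pick t = (SOME f. f \<in> F \<and> \<tau> f = t)" for t
  define U where "U t = {i \<in> S. B (pick t) i \<subseteq> snd t}" for t
  define W where "W t = {i \<in> S. B (pick t) i \<inter> snd t = {}}" for t
  define T where "T = {xs. set xs \<subseteq> N \<and> length xs = Suc k} \<times> Pow {..<k}"
  have seg: "segmented Ed src tgt s t k (v f) (seg f)" if "f \<in> F" for f using G[OF that] unfolding G_def by simp
  have sat: "\<sigma> (Z f) x = b" if "f \<in> F" "j < k" "e \<in> set (seg f j)" "lab e = Some (x, b)" for f j e x b
    using G[OF that(1)] that unfolding G_def by blast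
  have seg_swap: "segmented Ed src tgt s t k (v f) (seg g)" if fg: "f \<in> F" "g \<in> F" "\<tau> f = \<tau> g" for f g
  proof -
    have "map (v f) [0..<Suc k] = map (v g) [0..<Suc k]" using fg(3) unfolding \<tau>_def by blast
    then have "v f j = v g j" if "j \<le> k" for j using that by (simp only: map_eq_conv) auto
    then show ?thesis using seg[OF fg(2)] unfolding segmented_def by simp
  qed
  have B_cong: "B f i = B g i" if "f \<in> F" "g \<in> F" "\<tau> f = \<tau> g" "i \<in> S" for f g i
    unfolding B_def using reading_segs_cong[OF unif _ seg seg_swap] that X by blast
  have pick: "pick (\<tau> f) \<in> F \<and> \<tau> (pick (\<tau> f)) = \<tau> f" if "f \<in> F" for f
    unfolding pick_def by (rule someI[of _ f]) (simp add: that)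
  have U_eq: "U (\<tau> f) = {i \<in> S. B f i \<subseteq> A f}" if f: "f \<in> F" for f
    unfolding U_def using B_cong[of "pick (\<tau> f)" f] pick[OF f] f by (intro Collect_cong) (auto simp: \<tau>_def)
  have W_eq: "W (\<tau> f) = {i \<in> S. B f i \<inter> A f = {}}" if f: "f \<in> F" for f
    unfolding W_def using B_cong[of "pick (\<tau> f)" f] pick[OF f] f by (intro Collect_cong) (auto simp: \<tau>_def)
  \<comment> \<open>Every variable is read at least once, so no index set can be both inside
    \<open>A f\<close> and disjoint from it. This makes \<open>U\<close> and \<open>W\<close>
    disjoint.\<close>
  have B_ne: "B f i \<noteq> {}" if "f \<in> F" "i \<in> S" for f i
    unfolding B_def using reading_segs_card(2)[OF unif _ seg d] that X by blast
  have "K ^ q \<le> 2 * card T * (K - 1) ^ q"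
  proof (rule rectangle_cover_bound[where S = S and F = F and \<tau> = \<tau> and U = U and W = W and Y = Y])
    show "F \<subseteq> S \<rightarrow>\<^sub>E {..<K}" unfolding F_def by blast
    show "K ^ card S \<le> 2 * card F" unfolding F_def by (rule many_independent_zero_sets[OF S(1) Y K])
    show "finite T" unfolding T_def using nbp(1) by (simp add: finite_lists_length_eq)
    show "\<tau> ` F \<subseteq> T"
    proof (rule image_subsetI)
      fix f assume f: "f \<in> F"
      have "v f j \<in> N" if "j \<le> k" for j using segmented_nodes[OF seg[OF f] nbp(2,3) that] by simp
      moreover have "A f \<subseteq> {..<k}" using G[OF f] unfolding G_def by simp
      ultimately show "\<tau> f \<in> T" unfolding \<tau>_def T_def by auto
    qed
    show "U t \<subseteq> S \<and> W t \<subseteq> S \<and> U t \<inter> W t = {} \<and> 2 * q \<le> card (U t) \<and> 2 * q \<le> card (W t)"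
      if t: "t \<in> \<tau> ` F" for t
    proof -
      obtain f where f: "f \<in> F" "t = \<tau> f" using t by blast
      have "U t \<inter> W t = {}" unfolding f(2) U_eq[OF f(1)] W_eq[OF f(1)] using B_ne[OF f(1)] by blast
      moreover have "2 * q \<le> card (U t)" "2 * q \<le> card (W t)"
        unfolding f(2) U_eq[OF f(1)] W_eq[OF f(1)] B_def using G[OF f(1)] unfolding G_def by simp_all
      moreover have "U t \<subseteq> S" "W t \<subseteq> S" unfolding U_def W_def by auto
      ultimately show ?thesis by simp
    qed
    show "(i, j) \<notin> Y" if fg: "f \<in> F" "g \<in> F" "\<tau> f = \<tau> g"
      and agree: "\<And>x. x \<in> S - (U (\<tau> f) \<union> W (\<tau> f)) \<Longrightarrow> f x = g x"
      and ij: "i \<in> U (\<tau> f)" "j \<in> W (\<tau> f)" "f i = 0" "g j = 0" for f g i j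
    proof -
      \<comment> \<open>The spliced assignment follows \<open>f\<close> on \<open>U\<close> and
        \<open>g\<close> elsewhere. Outside \<open>U\<close> and \<open>W\<close> the two agree, so
        it differs from \<open>f\<close> only on \<open>W\<close>, which the segments in
        \<open>A f\<close> never read, and from \<open>g\<close> only on \<open>U\<close>, which the
        remaining segments never read.\<close>
      define I where "I = {x \<in> S. (if x \<in> U (\<tau> f) then f x else g x) = 0}"
      have fI: "\<sigma> I x = \<sigma> (Z f) x" if "x \<notin> r ` W (\<tau> f)" for x
      proof (cases "x \<in> r ` S")
        case True
        then obtain a where a: "a \<in> S" "x = r a" by blast
        then have "a \<notin> W (\<tau> f)" using that by blast
        then have "a \<in> I \<longleftrightarrow> a \<in> Z f" using agree[of a] a(1) unfolding I_def Z_def by auto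
        then show ?thesis unfolding a(2) using \<sigma>_root[OF a(1)] by simp
      qed (rule \<sigma>_other)
      have gI: "\<sigma> I x = \<sigma> (Z g) x" if "x \<notin> r ` U (\<tau> f)" for x
      proof (cases "x \<in> r ` S")
        case True
        then obtain a where a: "a \<in> S" "x = r a" by blast
        then have "a \<notin> U (\<tau> f)" using that by blast
        then have "a \<in> I \<longleftrightarrow> a \<in> Z g" using a(1) unfolding I_def Z_def by auto
        then show ?thesis unfolding a(2) using \<sigma>_root[OF a(1)] by simp
      qed (rule \<sigma>_other)
      have "\<phi> (\<sigma> I)"
      proof (rule spliced_path_accepts[OF comp seg[OF fg(1)] seg_swap[OF fg]])
        fix h e x b assume h: "h < k" "h \<in> A f" "e \<in> set (seg f h)" "lab e = Some (x, b)"
        have "x \<noteq> r a" if a: "a \<in> W (\<tau> f)" for a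
        proof
          assume "x = r a"
          then have "h \<in> B f a" using h unfolding B_def reading_segs_def reads_def by auto
          then show False using a h(2) unfolding W_eq[OF fg(1)] by blast
        qed
        then have "\<sigma> I x = \<sigma> (Z f) x" by (intro fI) blast
        then show "\<sigma> I x = b" using sat[OF fg(1) h(1,3,4)] by simp
      next
        fix h e x b assume h: "h < k" "h \<notin> A f" "e \<in> set (seg g h)" "lab e = Some (x, b)"
        have Ag: "A f = A g" using fg(3) unfolding \<tau>_def by simp
        have "x \<noteq> r a" if a: "a \<in> U (\<tau> f)" for a
        proof
          assume "x = r a"
          then have "h \<in> B g a" using h unfolding B_def reading_segs_def reads_def by auto
          then show False using a h(2) unfolding fg(3) U_eq[OF fg(2)] Ag by blast
        qed
        then have "\<sigma> I x = \<sigma> (Z g) x" by (intro gI) blast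
        then show "\<sigma> I x = b" using sat[OF fg(2) h(1,3,4)] by simp
      qed
      then have ind: "\<forall>(i, j)\<in>Y. i \<notin> I \<or> j \<notin> I" unfolding \<phi> .
      have "i \<in> I" using ij unfolding I_def U_def by simp
      moreover have "j \<notin> U (\<tau> f)"
        using ij(2) B_ne[OF fg(1), of j] unfolding U_eq[OF fg(1)] W_eq[OF fg(1)] by blast
      then have "j \<in> I" using ij unfolding I_def W_def by simp
      ultimately show ?thesis using ind by blast
    qed
  qed (use S K hit in auto)
  also have "card T = card N ^ (k + 1) * 2 ^ k"
    unfolding T_def using nbp(1) by (simp add: card_cartesian_product card_lists_length_eq card_Pow)
  finally show ?thesis unfolding k_def .
qed

section \<open>The lower bound\<close>

context btb
begin

lemma pseudoexpander_edge:
  assumes "pseudoexpander m TV TE r" "U \<subseteq> {..<m}" "W \<subseteq> {..<m}" "U \<inter> W = {}"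
    "real m powr 0.999 \<le> card U" "real m powr 0.999 \<le> card W" "0 < m"
  shows "\<exists>i\<in>U. \<exists>j\<in>W. adjacent_trees m TV TE r i j"
proof -
  obtain M where M: "pseudomatching_between m TV TE r M U W" "real m powr 0.999 / 3 \<le> card M"
    using assms unfolding pseudoexpander_def by blast
  have "0 < real m powr 0.999 / 3" using assms(7) by simp
  then have "card M \<noteq> 0" using M(2) by linarith
  then obtain e where e: "e \<in> M" by fastforce
  have "\<forall>e\<in>M. \<exists>i j. e = {i, j} \<and> adjacent_trees m TV TE r i j \<and> i \<in> U \<and> j \<in> W"
    using M(1) unfolding pseudomatching_between_def by (rule conjunct1)
  from bspec[OF this e] show ?thesis by blast
qed

text \<open>A one-vertex tree has a single neighbour, so many of them would have too small a joint neighbourhood.\<close>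
lemma few_small_trees:
  assumes pe: "pseudoexpander m TV TE r" and A: "real m powr 0.999 \<le> A" "3 * A \<le> m" and m: "0 < m"
  shows "m - A \<le> card big"
proof (rule ccontr)
  assume "\<not> m - A \<le> card big"
  moreover have "card ({..<m} - big) = m - card big"
    by (subst card_Diff_subset) (auto simp: big_def)
  ultimately have "A \<le> card ({..<m} - big)" by linarith
  then obtain U where U: "U \<subseteq> {..<m} - big" "card U = A" by (metis obtain_subset_with_card_n)
  have finU: "finite U" using U(1) finite_subset by blast
  \<comment> \<open>For a tree without neighbours the value is arbitrary; this only adds an element
    to the set removed below and leaves the count valid.\<close>
  define nb where "nb i = (THE j. adjacent_trees m TV TE r i j)" for i
  have nb: "nb i = j" if "i \<in> U" "adjacent_trees m TV TE r i j" for i j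
    unfolding nb_def using that U small_tree_adjacent_unique[of i j] by (intro the_equality) auto
  \<comment> \<open>At most \<open>2 * A\<close> roots are removed, so \<open>3 * A \<le> m\<close>
    leaves enough for expansion to yield an edge from \<open>U\<close> to a root that is no
    neighbour of \<open>U\<close>.\<close>
  define W where "W = {..<m} - (U \<union> nb ` U)"
  have "card (U \<union> nb ` U) \<le> A + A"
    using card_Un_le[of U "nb ` U"] card_image_le[OF finU, of nb] U(2) by linarith
  moreover have "card {..<m} - card (U \<union> nb ` U) \<le> card W"
    unfolding W_def using finU by (intro diff_card_le_card_Diff) auto
  ultimately have "A \<le> card W" using A(2) by simp
  then have "real m powr 0.999 \<le> card W" using A(1) by linarith
  then have "\<exists>i\<in>U. \<exists>j\<in>W. adjacent_trees m TV TE r i j"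
    using U A(1) m by (intro pseudoexpander_edge[OF pe]) (auto simp: W_def)
  then show False using nb unfolding W_def by blast
qed

text \<open>The argument is run on \<open>big\<close> alone. The summand \<open>A\<close> in
  \<open>size\<close> pays for the at most \<open>A\<close> one-vertex trees that are left
  out.\<close>

lemma pseudoexpander_nbp_bound:
  assumes pe: "pseudoexpander m TV TE r"
    and unif: "uniform_read N Ed src tgt lab s t d"
    and comp: "nbp_computes N Ed src tgt lab s t (HV m TV) (phi_H m TV TE r)"
    and A: "real m powr 0.999 \<le> A" "3 * A \<le> m" and m: "0 < m"
    and q: "b * A \<le> q" "0 < b * (q - A)"
    and T: "2 * m ^ 3 \<le> b * (q - A) * T" "2 * T \<le> K ^ 2" and K: "0 < K"
    and size: "4 * d + A \<le> m" "4 * 4 ^ d * q + A \<le> m"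
  shows "K ^ q \<le> 2 * (card N ^ (4 * d ^ 2 + 1) * 2 ^ (4 * d ^ 2)) * (K - 1) ^ q"
proof -
  let ?E = "{(i, j). i \<in> big \<and> j \<in> big \<and> adjacent_trees m TV TE r i j}"
  have big: "big \<subseteq> {..<m}" unfolding big_def by auto
  then have fin: "finite big" using finite_subset by blast
  have card: "m - A \<le> card big" "card big \<le> m" using few_small_trees[OF pe A m] card_mono[OF _ big] by simp_all
  have "0 < card big" using card(1) A(2) m by linarith
  then have ne: "big \<noteq> {}" by auto
  have "card big ^ 3 \<le> m ^ 3" using card(2) by (rule power_mono) simp
  then have T': "2 * card big ^ 3 \<le> b * (q - A) * T" using T(1) by linarith
  have exp: "\<exists>i\<in>U. \<exists>j\<in>W. (i, j) \<in> ?E"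
    if UW: "U \<subseteq> big" "W \<subseteq> big" "U \<inter> W = {}" "card U = A" "card W = A" for U W
  proof -
    have "\<exists>i\<in>U. \<exists>j\<in>W. adjacent_trees m TV TE r i j"
      using UW big A(1) m by (intro pseudoexpander_edge[OF pe]) auto
    then show ?thesis using UW by blast
  qed
  have sub: "?E \<subseteq> big \<times> big" by auto
  obtain Y where Y: "Y \<subseteq> ?E" "card Y \<le> T"
    "\<And>U W. U \<subseteq> big \<Longrightarrow> W \<subseteq> big \<Longrightarrow> U \<inter> W = {} \<Longrightarrow> q \<le> card U \<Longrightarrow> q \<le> card W
      \<Longrightarrow> \<exists>i\<in>U. \<exists>j\<in>W. (i, j) \<in> Y"
    by (rule expander_hitting_pairs[OF exp fin ne sub q(1) refl q(2) T']) (assumption+, rule that)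
  show ?thesis
  proof (rule uniform_nbp_independent_bound[OF unif comp fin, where r = r and \<sigma> = "asg Y" and Y = Y])
    show "inj_on r big" using inj_r big by (rule inj_on_subset)
    show "r ` big \<subseteq> HV m TV" using root_in_tree big unfolding HV_def by blast
    show "phi_H m TV TE r (asg Y I) = (\<forall>(i, j)\<in>Y. i \<notin> I \<or> j \<notin> I)" for I by (rule phi_H_asg[OF Y(1)])
    show "Y \<subseteq> big \<times> big" using Y(1) by auto
    show "(i, i) \<notin> Y" for i using Y(1) unfolding adjacent_trees_def by auto
    show "2 * card Y \<le> K ^ 2" using Y(2) T(2) by linarith
    show "\<exists>i\<in>U. \<exists>j\<in>W. (i, j) \<in> Y"
      if "U \<subseteq> big" "W \<subseteq> big" "U \<inter> W = {}" "q \<le> card U" "q \<le> card W" for U W using that by (rule Y(3))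
    show "asg Y I x = asg Y J x" if "x \<notin> r ` big" for I J x using that by (rule asg_other)
    show "4 * d \<le> card big" "4 * 4 ^ d * q \<le> card big" using size card(1) by linarith+
  qed (use asg_root K in auto)
qed

end

section \<open>Choice of parameters\<close>

text \<open>The estimate \<open>1 - 1 / K \<le> exp (- 1 / K)\<close> is raised to the power
  \<open>q\<close>; the numerical factors combine to \<open>2 ^ (k + 1)\<close> and join the powers
  of \<open>M\<close>.\<close>

lemma exp_le_of_power_le:
  fixes K q M k :: nat
  assumes "K ^ q \<le> 2 * (M ^ (k + 1) * 2 ^ k) * (K - 1) ^ q" "0 < K"
  shows "exp (q / K) \<le> (2 * real M) ^ (k + 1)"
proof -
  have "real (K - 1) ^ q = real K ^ q * (1 - 1 / K) ^ q"
    using assms(2) by (simp add: of_nat_diff field_simps flip: power_mult_distrib)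
  also have "\<dots> \<le> real K ^ q * exp (- 1 / K) ^ q"
    using assms(2) exp_ge_add_one_self[of "- 1 / K"] by (intro mult_left_mono power_mono) (auto simp: field_simps)
  also have "exp (- 1 / K) ^ q = inverse (exp (q / K))"
    by (simp flip: exp_of_nat_mult exp_minus)
  finally have *: "real (K - 1) ^ q \<le> real K ^ q * inverse (exp (q / K))" .
  have "2 * (M ^ (k + 1) * 2 ^ k) = (2 * M) ^ (k + 1)" by (simp add: power_mult_distrib)
  then have "real (K ^ q) \<le> real ((2 * M) ^ (k + 1) * (K - 1) ^ q)" using assms(1) by (simp only: of_nat_le_iff)
  then have "real K ^ q \<le> (2 * real M) ^ (k + 1) * real (K - 1) ^ q" by simp
  also have "\<dots> \<le> (2 * real M) ^ (k + 1) * (real K ^ q * inverse (exp (q / K)))"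
    using * by (rule mult_left_mono) simp
  finally have "real K ^ q * 1 \<le> real K ^ q * ((2 * real M) ^ (k + 1) * inverse (exp (q / K)))"
    by (simp add: mult_ac)
  then have "1 \<le> (2 * real M) ^ (k + 1) * inverse (exp (q / K))"
    using assms(2) by (subst (asm) mult_le_cancel_left_pos) auto
  then show ?thesis by (simp add: field_simps)
qed

text \<open>With \<open>x\<close> trees, the proof takes \<open>A = x powr 0.999\<close>, \<open>q = x powr 0.9999\<close>, \<open>b = q / A\<close>, a hitting set of
  \<open>8 * x powr 1.9992\<close> pairs and \<open>K = 5 * x powr 0.9996\<close>, all up to rounding; \<open>4 * x ^ 3\<close> bounds the number
  of vertices of the graph.\<close>
locale large_enough =
  fixes x :: real
  assumes few_small: "3 * (x powr 0.999 + 1) \<le> x"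
    and hitting: "2 * x ^ 3 \<le> ((x powr 0.9999 - 1) / (x powr 0.999 + 1) - 1)
       * (x powr 0.9999 - x powr 0.999 - 2) * (8 * x powr 1.9992)"
    and independent: "2 * (8 * x powr 1.9992 + 1) \<le> (5 * x powr 0.9996) ^ 2"
    and reads_few: "4 * (log 2 (4 * x ^ 3) / 10 ^ 5) + (x powr 0.999 + 1) \<le> x"
    and rectangle: "4 * (4 * x ^ 3) powr (2 / 10 ^ 5) * x powr 0.9999 + (x powr 0.999 + 1) \<le> x"
    and growth: "((4 * x ^ 3) powr (1 / 10 ^ 5) + 1) * (4 * (log 2 (4 * x ^ 3) / 10 ^ 5) ^ 2 + 1)
       \<le> (x powr 0.9999 - 1) / (5 * x powr 0.9996 + 1)"
    and pos: "0 < x powr 0.9999 - x powr 0.999 - 2" "0 < (x powr 0.9999 - 1) / (x powr 0.999 + 1) - 1"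

text \<open>In \<open>hitting\<close> and \<open>independent\<close> the leading exponents of both
  sides agree (3 and 1.9992), so the constants decide: 2 against 8 and 16 against 25. In
  \<open>rectangle\<close> the exponent 0.00006 + 0.9999 stays below 1, and in \<open>growth\<close>
  0.00003 with a squared logarithm faces 0.0003.\<close>

lemma eventually_large_enough: "eventually large_enough at_top"
  unfolding large_enough_def by (intro eventually_conj; real_asymp)

theorem theorem4:
  shows "\<exists>\<alpha>::real. \<exists>\<beta>::real. \<alpha> > 1 \<and> 0 < \<beta> \<and> \<beta> < 1 \<and>
    (\<exists>n0::nat. \<forall>(m::nat) (TV::nat \<Rightarrow> nat set) (TE::nat \<Rightarrow> nat set set) (r::nat \<Rightarrow> nat)
        (d::nat) (N::nat set) (Ed::nat set) (src::nat \<Rightarrow> nat) (tgt::nat \<Rightarrow> nat)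
        (lab::nat \<Rightarrow> (nat \<times> bool) option) (s::nat) (t::nat).
       pseudoexpander m TV TE r \<longrightarrow>
       card (HV m TV) \<ge> n0 \<longrightarrow>
       real d \<le> log 2 (real (card (HV m TV))) / 10^5 \<longrightarrow>
       uniform_read N Ed src tgt lab s t d \<longrightarrow>
       nbp_computes N Ed src tgt lab s t (HV m TV) (phi_H m TV TE r) \<longrightarrow>
       real (card N) \<ge> \<alpha> powr (real (card (HV m TV)) powr \<beta>))"
proof -
  obtain x0 where x0: "\<And>x. x0 \<le> x \<Longrightarrow> large_enough x"
    using eventually_large_enough unfolding eventually_at_top_linorder by blast
  \<comment> \<open>As the graph has at most \<open>4 * m ^ 3\<close> vertices,
    \<open>4 * m0 ^ 3 + 1\<close> of them force \<open>m0 \<le> m\<close>; this turns a large number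
    of vertices into a large number of trees.\<close>
  define m0 where "m0 = nat \<lceil>x0\<rceil>"
  have main: "exp 1 powr (real (card (HV m TV)) powr (1 / 10 ^ 5)) \<le> card N"
    if pe: "pseudoexpander m TV TE r" and n0: "4 * m0 ^ 3 + 1 \<le> card (HV m TV)"
      and d: "real d \<le> log 2 (real (card (HV m TV))) / 10^5"
      and unif: "uniform_read N Ed src tgt lab s t d"
      and comp: "nbp_computes N Ed src tgt lab s t (HV m TV) (phi_H m TV TE r)"
    for m d s t :: nat and TV TE r N and Ed :: "nat set" and src tgt lab
  proof -
    interpret btb m TV TE r using pe unfolding pseudoexpander_def by unfold_locales simp
    define n where "n = card (HV m TV)"
    have m: "0 < m" using n0 by (cases "m = 0") (auto simp: HV_def)
    have n: "n \<le> 4 * m ^ 3" unfolding n_def using pe m by (intro card_HV) (auto simp: pseudoexpander_def)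
    have "m0 \<le> m"
    proof (rule ccontr)
      assume "\<not> m0 \<le> m"
      then have "m ^ 3 \<le> m0 ^ 3" by (intro power_mono) auto
      then show False using n n0 unfolding n_def by linarith
    qed
    then have "x0 \<le> real m" unfolding m0_def by linarith
    define x where "x = real m"
    have "large_enough x" using x0 \<open>x0 \<le> real m\<close> unfolding x_def by blast
    then interpret L: large_enough x .
    have x: "0 < x" using m unfolding x_def by simp
    have rn: "real n \<le> 4 * x ^ 3" using n unfolding x_def
      by (metis of_nat_le_iff of_nat_mult of_nat_numeral of_nat_power)
    have n1: "1 \<le> real n" using n0 unfolding n_def by linarith
    define A where "A = nat \<lceil>x powr 0.999\<rceil>"
    define q where "q = nat \<lfloor>x powr 0.9999\<rfloor>"
    define b where "b = q div A"
    define T where "T = nat \<lceil>8 * x powr 1.9992\<rceil>"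
    define K where "K = nat \<lceil>5 * x powr 0.9996\<rceil>"
    have ceil: "y \<le> nat \<lceil>y\<rceil>" "nat \<lceil>y\<rceil> \<le> y + 1" and floor: "nat \<lfloor>y\<rfloor> \<le> y" "y - 1 \<le> nat \<lfloor>y\<rfloor>"
      if "0 \<le> y" for y :: real using that by linarith+
    have A: "x powr 0.999 \<le> A" "A \<le> x powr 0.999 + 1" unfolding A_def by (simp_all only: ceil powr_ge_zero)
    have A0: "0 < real A" using A(1) x by (smt (verit) powr_gt_zero)
    have q: "q \<le> x powr 0.9999" "x powr 0.9999 - 1 \<le> q" unfolding q_def by (simp_all only: floor powr_ge_zero)
    have T: "8 * x powr 1.9992 \<le> T" "T \<le> 8 * x powr 1.9992 + 1" unfolding T_def by (rule ceil, simp)+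
    have K: "5 * x powr 0.9996 \<le> K" "K \<le> 5 * x powr 0.9996 + 1" unfolding K_def by (rule ceil, simp)+
    have K0: "0 < K" using K(1) x by (smt (verit) of_nat_0_less_iff powr_gt_zero)
    have b: "(x powr 0.9999 - 1) / (x powr 0.999 + 1) - 1 \<le> b"
    proof -
      have "(x powr 0.9999 - 1) / (x powr 0.999 + 1) \<le> q / A" using q(2) A A0 by (intro frac_le) auto
      moreover have "q < A * (b + 1)" unfolding b_def using A0 dividend_less_times_div[of A q] by simp
      then have "real q < real (A * (b + 1))" by (simp only: of_nat_less_iff)
      then have "q / A < b + 1" using A0 by (simp add: field_simps)
      ultimately show ?thesis by simp
    qed
    have qA: "x powr 0.9999 - x powr 0.999 - 2 \<le> real (q - A)" using A(2) q(2) by linarith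
    define L where "L = log 2 (4 * x ^ 3) / 10 ^ 5"
    have "log 2 n \<le> log 2 (4 * x ^ 3)" using rn n1 by (intro log_mono) auto
    then have dL: "real d \<le> L" using d unfolding L_def n_def by (simp add: divide_right_mono)
    \<comment> \<open>The bound on \<open>d\<close> makes \<open>4 ^ d\<close> a tiny power of the
      number of trees, so the loss in the separation is affordable.\<close>
    have pow4: "4 ^ d \<le> (4 * x ^ 3) powr (2 / 10 ^ 5)"
    proof -
      have "(4 :: real) ^ d = 2 powr (2 * d)" by (simp add: powr_realpow[symmetric] powr_powr[symmetric])
      also have "\<dots> \<le> 2 powr (2 * L)" using dL by simp
      also have "\<dots> = (2 powr log 2 (4 * x ^ 3)) powr (2 / 10 ^ 5)" unfolding L_def powr_powr by simp
      also have "\<dots> = (4 * x ^ 3) powr (2 / 10 ^ 5)" using x by simp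
      finally show ?thesis .
    qed
    have "K ^ q \<le> 2 * (card N ^ (4 * d ^ 2 + 1) * 2 ^ (4 * d ^ 2)) * (K - 1) ^ q"
    proof (rule pseudoexpander_nbp_bound[OF pe unif comp _ _ m])
      show "real m powr 0.999 \<le> A" using A(1) unfolding x_def .
      have "3 * real A \<le> 3 * (x powr 0.999 + 1)" using A(2) by (intro mult_left_mono) auto
      also have "\<dots> \<le> m" using L.few_small unfolding x_def .
      finally show "3 * A \<le> m" by linarith
      show "b * A \<le> q" unfolding b_def by simp
      show "0 < K" by (rule K0)
      have "0 < b" using b L.pos by (smt (verit) of_nat_0_less_iff)
      moreover have "0 < q - A" using qA L.pos by (smt (verit) of_nat_0_less_iff)
      ultimately show "0 < b * (q - A)" by simp
      have "2 * x ^ 3 \<le> ((x powr 0.9999 - 1) / (x powr 0.999 + 1) - 1)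
          * (x powr 0.9999 - x powr 0.999 - 2) * (8 * x powr 1.9992)" by (rule L.hitting)
      also have "\<dots> \<le> real b * real (q - A) * real T"
        using b qA T(1) L.pos by (intro mult_mono) auto
      finally have "real (2 * m ^ 3) \<le> real (b * (q - A) * T)" unfolding x_def by simp
      then show "2 * m ^ 3 \<le> b * (q - A) * T" by (simp only: of_nat_le_iff)
      have "real (2 * T) \<le> (5 * x powr 0.9996) ^ 2" using T(2) L.independent by simp
      also have "\<dots> \<le> real K ^ 2" using K(1) by (intro power_mono) auto
      finally show "2 * T \<le> K ^ 2" by (simp flip: of_nat_power)
      have "4 * real d + A \<le> 4 * L + (x powr 0.999 + 1)" using dL A(2) by (intro add_mono mult_left_mono) auto
      also have "\<dots> \<le> m" using L.reads_few unfolding L_def x_def .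
      finally show "4 * d + A \<le> m" by linarith
      have "4 * 4 ^ d * real q \<le> 4 * (4 * x ^ 3) powr (2 / 10 ^ 5) * x powr 0.9999"
        using pow4 q(1) by (intro mult_mono) auto
      then have "4 * 4 ^ d * real q + A \<le> 4 * (4 * x ^ 3) powr (2 / 10 ^ 5) * x powr 0.9999 + (x powr 0.999 + 1)"
        using A(2) by (rule add_mono)
      also have "\<dots> \<le> m" using L.rectangle unfolding x_def .
      finally have "real (4 * 4 ^ d * q + A) \<le> real m" by simp
      then show "4 * 4 ^ d * q + A \<le> m" by (simp only: of_nat_le_iff)
    qed
    then have "exp (q / K) \<le> (2 * real (card N)) ^ (4 * d ^ 2 + 1)" using K0 by (rule exp_le_of_power_le)
    moreover have N: "0 < card N" using unif unfolding uniform_read_def is_nbp_def by (auto simp: card_gt_0_iff)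
    ultimately have "ln (exp (q / K)) \<le> ln ((2 * real (card N)) ^ (4 * d ^ 2 + 1))" by (intro ln_mono) auto
    also have "\<dots> = real (4 * d ^ 2 + 1) * ln (2 * real (card N))" by (rule ln_realpow)
    finally have lnN: "q / K \<le> (4 * real d ^ 2 + 1) * ln (2 * card N)" by (simp add: add.commute)
    \<comment> \<open>The extra 1 absorbs the factor 2 in \<open>2 * card N\<close>, since
      \<open>ln 2 < 1\<close>. The final constants are therefore the base \<open>exp 1\<close> and
      the exponent \<open>1 / 10 ^ 5\<close>.\<close>
    have "(real n powr (1 / 10 ^ 5) + 1) * (4 * real d ^ 2 + 1)
        \<le> ((4 * x ^ 3) powr (1 / 10 ^ 5) + 1) * (4 * L ^ 2 + 1)"
      using rn dL by (intro mult_mono add_mono powr_mono2 power_mono order_refl) auto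
    also have "\<dots> \<le> (x powr 0.9999 - 1) / (5 * x powr 0.9996 + 1)" unfolding L_def by (rule L.growth)
    also have "\<dots> \<le> q / K" using q(2) K K0 x by (intro frac_le) auto
    also note lnN
    finally have "real n powr (1 / 10 ^ 5) + 1 \<le> ln (2 * card N)"
      by (subst (asm) mult.commute) (subst (asm) mult_le_cancel_left_pos, auto intro: add_nonneg_pos)
    also have "\<dots> \<le> 1 + ln (card N)" using N ln_2_less_1 by (simp add: ln_mult)
    finally have "real n powr (1 / 10 ^ 5) \<le> ln (card N)" by simp
    then have "exp (real n powr (1 / 10 ^ 5)) \<le> card N" using N by (simp add: ln_ge_iff)
    then show ?thesis unfolding n_def by (simp add: powr_def)
  qed
  show ?thesis
    by (intro exI[of _ "exp 1"] exI[of _ "1 / 10 ^ 5"] conjI exI[of _ "4 * m0 ^ 3 + 1"] allI impI main) auto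
qed

end
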